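(* Let $n\in\mathbb{N}$, $\mathbb{A}=(A_1,\dots,A_n)\in\mathbb{P}^n$ and $\omega=(w_1,\dots,w_n)\in\Delta_n$. Then for $0\le t<z\le1$ $$\lim_{p\to0^-}\mathcal{R}_{t,z}(\omega;\mathbb{A}^p)^{1/p} \preceq \lim_{p\to0^+}\mathcal{R}_{t,z}(\omega;\mathbb{A}^p)^{1/p},$$ when the limits exist. In addition (when the respective limit exists): (i) $\lim_{p\to0^+}\mathcal{R}_{t,z}(\omega;\mathbb{A}^p)^{1/p}\preceq \mathrm{LE}(\omega;\mathbb{A}^{1-t})$ when $A_j\le I$ for all $j$; (ii) $\lim_{p\to0^-}\mathcal{R}_{t,z}(\omega;\mathbb{A}^p)^{1/p}\succeq \mathrm{LE}(\omega;\mathbb{A}^{1-t})$ when $A_j\ge I$ for all $j$.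
   Context: $\mathbb{P}$ is the open convex cone of positive definite (positive and invertible) bounded linear operators on a Hilbert space. The Loewner order $X \le Y$ on self-adjoint operators means $Y - X$ is positive semi-definite. The metric geometric mean is $A \# B = A^{1/2}(A^{-1/2} B A^{-1/2})^{1/2}A^{1/2}$ for $A,B\in\mathbb{P}$. The near-order on $\mathbb{P}$ is defined by: $A \preceq B$ (equivalently written $B\succeq A$) if and only if $A^{-1}\# B \ge I$. $\Delta_n$ is the set of probability vectors in $\mathbb{R}^n$ with all entries positive. For $p\in\mathbb{R}$, $\mathbb{A}^p=(A_1^p,\dots,A_n^p)$. The log-Euclidean mean is $\mathrm{LE}(\omega;\mathbb{A})=\exp\left(\sum_{j=1}^n w_j\log A_j\right)$. For $0\le t<z\le1$, the R\'enyi power mean $\mathcal{R}_{t,z}(\omega;\mathbb{A})$ is the unique solution $X\in\mathbb{P}$ (known to exist) of the equation $X=\sum_{j=1}^n w_j\left(A_j^{\frac{1-t}{2z}}X^{\frac{t}{z}}A_j^{\frac{1-t}{2z}}\right)^z$. Limits are taken in $\mathbb{P}$ with respect to the Thompson metric $d_T(A,B)=\|\log(A^{-1/2}BA^{-1/2})\|$, with $\|\cdot\|$ the operator norm. *)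

theory Defs
  imports "HOL-Analysis.Analysis" "HOL-Computational_Algebra.Polynomial"
begin

section \<open>Complex Hilbert spaces\<close>

text \<open>The real inner product is the real part of the complex one, so that norm, metric and topology
  are those of the library class \<^class>\<open>real_inner\<close>. The complex inner product is antilinear in
  its first argument (additivity and homogeneity there follow from conjugate symmetry).\<close>

class complex_inner = real_inner +
  fixes scaleC :: "complex \<Rightarrow> 'a \<Rightarrow> 'a"  (infixr "*\<^sub>C" 75)
    and cinner :: "'a \<Rightarrow> 'a \<Rightarrow> complex"
  assumes scaleC_add_right: "a *\<^sub>C (x + y) = a *\<^sub>C x + a *\<^sub>C y"
    and scaleC_add_left: "(a + b) *\<^sub>C x = a *\<^sub>C x + b *\<^sub>C x"
    and scaleC_scaleC: "a *\<^sub>C (b *\<^sub>C x) = (a * b) *\<^sub>C x"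
    and scaleR_scaleC: "r *\<^sub>R x = complex_of_real r *\<^sub>C x"
    and cinner_commute: "cinner x y = cnj (cinner y x)"
    and cinner_add_right: "cinner x (y + z) = cinner x y + cinner x z"
    and cinner_scaleC_right: "cinner x (a *\<^sub>C y) = a * cinner x y"
    and inner_eq_Re_cinner: "inner x y = Re (cinner x y)"

class chilbert_space = complex_inner + complete_space

text \<open>The class is inhabited: the complex numbers and the spaces of finite tuples.\<close>

instantiation complex :: chilbert_space
begin
definition scaleC_complex :: "complex \<Rightarrow> complex \<Rightarrow> complex"
  where "scaleC_complex a x = a * x"
definition cinner_complex :: "complex \<Rightarrow> complex \<Rightarrow> complex"
  where "cinner_complex x y = cnj x * y"
instance
  by standard
    (simp_all add: scaleC_complex_def cinner_complex_def inner_complex_def algebra_simps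
      scaleR_conv_of_real)
end

instantiation vec :: (chilbert_space, finite) chilbert_space
begin
definition scaleC_vec :: "complex \<Rightarrow> 'a ^ 'b \<Rightarrow> 'a ^ 'b"
  where "scaleC_vec a x = (\<chi> i. a *\<^sub>C (x $ i))"
definition cinner_vec :: "'a ^ 'b \<Rightarrow> 'a ^ 'b \<Rightarrow> complex"
  where "cinner_vec x y = (\<Sum>i\<in>UNIV. cinner (x $ i) (y $ i))"
instance
proof
  fix x y :: "'a ^ 'b"
  have "cinner (x $ i) (y $ i) = cnj (cinner (y $ i) (x $ i))" for i
    by (rule cinner_commute)
  then show "cinner x y = cnj (cinner y x)"
    unfolding cinner_vec_def cnj_sum by (rule sum.cong[OF refl])
qed (simp_all add: scaleC_vec_def cinner_vec_def vec_eq_iff inner_vec_def scaleC_add_right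
      scaleC_add_left scaleC_scaleC scaleR_scaleC cinner_add_right cinner_scaleC_right
      inner_eq_Re_cinner sum.distrib sum_distrib_left)
end


section \<open>Bounded operators, positivity and the Loewner order\<close>

text \<open>Bounded operators are elements of \<open>'a \<Rightarrow>\<^sub>L 'a\<close>, whose norm is the operator norm. That type
  only demands real linearity; complex linearity is the predicate \<open>complex_linear\<close>.\<close>

definition complex_linear :: "('a::chilbert_space \<Rightarrow>\<^sub>L 'a) \<Rightarrow> bool"
  where "complex_linear A \<longleftrightarrow> (\<forall>c x. blinfun_apply A (c *\<^sub>C x) = c *\<^sub>C blinfun_apply A x)"

definition selfadjoint :: "('a::chilbert_space \<Rightarrow>\<^sub>L 'a) \<Rightarrow> bool"
  where "selfadjoint A \<longleftrightarrow> complex_linear A \<and>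
    (\<forall>x y. cinner (blinfun_apply A x) y = cinner x (blinfun_apply A y))"

definition pos_semidef :: "('a::chilbert_space \<Rightarrow>\<^sub>L 'a) \<Rightarrow> bool"
  where "pos_semidef A \<longleftrightarrow> selfadjoint A \<and> (\<forall>x. 0 \<le> Re (cinner x (blinfun_apply A x)))"

definition op_invertible :: "('a::chilbert_space \<Rightarrow>\<^sub>L 'a) \<Rightarrow> bool"
  where "op_invertible A \<longleftrightarrow> (\<exists>B. A o\<^sub>L B = id_blinfun \<and> B o\<^sub>L A = id_blinfun)"

definition op_inverse :: "('a::chilbert_space \<Rightarrow>\<^sub>L 'a) \<Rightarrow> ('a \<Rightarrow>\<^sub>L 'a)"
  where "op_inverse A = (THE B. A o\<^sub>L B = id_blinfun \<and> B o\<^sub>L A = id_blinfun)"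

definition PD :: "('a::chilbert_space \<Rightarrow>\<^sub>L 'a) set"
  where "PD = {A. pos_semidef A \<and> op_invertible A}"

definition loewner_le :: "('a::chilbert_space \<Rightarrow>\<^sub>L 'a) \<Rightarrow> ('a \<Rightarrow>\<^sub>L 'a) \<Rightarrow> bool"
  where "loewner_le X Y \<longleftrightarrow> pos_semidef (Y - X)"


section \<open>Continuous functional calculus\<close>

text \<open>Only used for self-adjoint operators, whose spectrum is real.\<close>

definition op_spectrum :: "('a::chilbert_space \<Rightarrow>\<^sub>L 'a) \<Rightarrow> real set"
  where "op_spectrum A = {x. \<not> op_invertible (A - x *\<^sub>R id_blinfun)}"

definition poly_op :: "real poly \<Rightarrow> ('a::chilbert_space \<Rightarrow>\<^sub>L 'a) \<Rightarrow> ('a \<Rightarrow>\<^sub>L 'a)"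
  where "poly_op q A = (\<Sum>i\<le>degree q. coeff q i *\<^sub>R (((o\<^sub>L) A ^^ i) id_blinfun))"

text \<open>For \<open>A\<close> self-adjoint and \<open>f\<close> continuous on the (compact) spectrum of \<open>A\<close>, the operator \<open>f(A)\<close>
  is the common norm limit of \<open>q\<^sub>k(A)\<close> over all polynomial sequences \<open>q\<^sub>k\<close> that converge to \<open>f\<close>
  uniformly on the spectrum. Such sequences exist by the Weierstrass theorem.\<close>

definition cfc :: "(real \<Rightarrow> real) \<Rightarrow> ('a::chilbert_space \<Rightarrow>\<^sub>L 'a) \<Rightarrow> ('a \<Rightarrow>\<^sub>L 'a)"
  where "cfc f A = (THE B. \<forall>q :: nat \<Rightarrow> real poly.
    uniform_limit (op_spectrum A) (\<lambda>k. poly (q k)) f sequentially \<longrightarrow>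
    (\<lambda>k. poly_op (q k) A) \<longlonglongrightarrow> B)"

definition op_powr :: "('a::chilbert_space \<Rightarrow>\<^sub>L 'a) \<Rightarrow> real \<Rightarrow> ('a \<Rightarrow>\<^sub>L 'a)"
  where "op_powr A r = cfc (\<lambda>x. x powr r) A"

definition op_log :: "('a::chilbert_space \<Rightarrow>\<^sub>L 'a) \<Rightarrow> ('a \<Rightarrow>\<^sub>L 'a)"
  where "op_log A = cfc ln A"

definition op_exp :: "('a::chilbert_space \<Rightarrow>\<^sub>L 'a) \<Rightarrow> ('a \<Rightarrow>\<^sub>L 'a)"
  where "op_exp A = cfc exp A"


section \<open>Means, near-order and Thompson metric\<close>

definition geom_mean :: "('a::chilbert_space \<Rightarrow>\<^sub>L 'a) \<Rightarrow> ('a \<Rightarrow>\<^sub>L 'a) \<Rightarrow> ('a \<Rightarrow>\<^sub>L 'a)"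
  where "geom_mean A B =
    op_powr A (1/2) o\<^sub>L op_powr (op_powr A (-1/2) o\<^sub>L B o\<^sub>L op_powr A (-1/2)) (1/2)
      o\<^sub>L op_powr A (1/2)"

definition near_le :: "('a::chilbert_space \<Rightarrow>\<^sub>L 'a) \<Rightarrow> ('a \<Rightarrow>\<^sub>L 'a) \<Rightarrow> bool"
  where "near_le A B \<longleftrightarrow> loewner_le id_blinfun (geom_mean (op_inverse A) B)"

definition thompson :: "('a::chilbert_space \<Rightarrow>\<^sub>L 'a) \<Rightarrow> ('a \<Rightarrow>\<^sub>L 'a) \<Rightarrow> real"
  where "thompson A B = norm (op_log (op_powr A (-1/2) o\<^sub>L B o\<^sub>L op_powr A (-1/2)))"

definition thompson_lim :: "('b \<Rightarrow> ('a::chilbert_space \<Rightarrow>\<^sub>L 'a)) \<Rightarrow> ('a \<Rightarrow>\<^sub>L 'a) \<Rightarrow> 'b filter \<Rightarrow> bool"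
  where "thompson_lim X L F \<longleftrightarrow> L \<in> PD \<and> ((\<lambda>p. thompson (X p) L) \<longlongrightarrow> 0) F"

text \<open>An \<open>n\<close>-tuple is a function on \<^typ>\<open>nat\<close> of which only the values on \<open>{1..n}\<close> matter.\<close>

definition prob_vectors :: "nat \<Rightarrow> (nat \<Rightarrow> real) set"
  where "prob_vectors n = {w. (\<forall>j\<in>{1..n}. 0 < w j) \<and> (\<Sum>j=1..n. w j) = 1}"

definition tuple_powr :: "(nat \<Rightarrow> ('a::chilbert_space \<Rightarrow>\<^sub>L 'a)) \<Rightarrow> real \<Rightarrow> (nat \<Rightarrow> ('a \<Rightarrow>\<^sub>L 'a))"
  where "tuple_powr A p = (\<lambda>j. op_powr (A j) p)"

definition log_euclidean ::
    "nat \<Rightarrow> (nat \<Rightarrow> real) \<Rightarrow> (nat \<Rightarrow> ('a::chilbert_space \<Rightarrow>\<^sub>L 'a)) \<Rightarrow> ('a \<Rightarrow>\<^sub>L 'a)"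
  where "log_euclidean n w A = op_exp (\<Sum>j=1..n. w j *\<^sub>R op_log (A j))"

definition renyi_mean ::
    "real \<Rightarrow> real \<Rightarrow> nat \<Rightarrow> (nat \<Rightarrow> real) \<Rightarrow> (nat \<Rightarrow> ('a::chilbert_space \<Rightarrow>\<^sub>L 'a)) \<Rightarrow> ('a \<Rightarrow>\<^sub>L 'a)"
  where "renyi_mean t z n w A = (THE X. X \<in> PD \<and>
    X = (\<Sum>j=1..n. w j *\<^sub>R
      op_powr (op_powr (A j) ((1 - t) / (2 * z)) o\<^sub>L op_powr X (t / z)
        o\<^sub>L op_powr (A j) ((1 - t) / (2 * z))) z))"

end

theory Submission
  imports Defs "HOL-Computational_Algebra.Fundamental_Theorem_Algebra"
begin

text \<open>Both one-sided limits equal the log-Euclidean mean \<open>exp H\<close> of the tuple \<open>A\<close> itself, where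
\<open>H = \<Sum>\<^sub>j w\<^sub>j log A\<^sub>j\<close>. The first claim is therefore the reflexivity \<open>E\<^bsup>-1\<^esup> # E = I\<close> of the near-order. In the other two
claims \<open>exp H\<close> is compared with the log-Euclidean mean \<open>exp ((1 - t) H)\<close> of the powers, a function of the same
operator, so the near-order reduces to the scalar comparison of \<open>x\<close> with \<open>(1 - t) x\<close> on the spectrum of \<open>H\<close>
(\<open>near_le_cfc\<close>): if all \<open>A\<^sub>j \<le> I\<close>, then \<open>H \<le> 0\<close>; if all \<open>A\<^sub>j \<ge> I\<close>, then \<open>H \<ge> 0\<close>.

The limit is computed by a first-order expansion at \<open>p = 0\<close>. The Renyi mean \<open>X\<^sub>p\<close> of the powers \<open>A\<^sup>p\<close> is the fixed
point of a map \<open>F\<^sub>p\<close> built from powers of operators near the identity. Since \<open>A\<^sup>p = I + p log A + o(p)\<close> and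
\<open>(I + K)\<^sup>r = I + r K + o(K)\<close>, the curve \<open>Y\<^sub>p = exp (p H)\<close> satisfies \<open>F\<^sub>p Y\<^sub>p = Y\<^sub>p + o(p)\<close>
(\<open>renyi_map_curve_has_vector_derivative\<close>). The map \<open>F\<^sub>p\<close> is order preserving, by the Loewner-Heinz inequality, and
homogeneous of degree \<open>t < 1\<close>. For such a map an approximate fixed point is near the true one
(\<open>subsolution_le_supersolution\<close>), so \<open>X\<^sub>p = I + p H + o(p)\<close>. Hence \<open>log X\<^sub>p / p\<close> tends to \<open>H\<close> and
\<open>X\<^bsub>p\<^esub>\<^bsup>1/p\<^esup> = exp (log X\<^sub>p / p)\<close> tends to \<open>exp H\<close> in norm. A Thompson limit of a norm convergent family is its norm
limit (\<open>thompson_lim_unique\<close>).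

Existence and uniqueness of the fixed point, the Loewner-Heinz inequality and the calculus of continuous
functions of a self-adjoint operator are established on the way. The calculus rests on \<open>norm_poly_op_le\<close>, the
bound of \<open>\<parallel>q(A)\<parallel>\<close> by the supremum of \<open>\<bar>q\<bar>\<close> over the spectrum.\<close>

section \<open>Self-adjoint operators\<close>

instance chilbert_space \<subseteq> banach ..

lemma scaleC_scaleR_commute: "c *\<^sub>C (r *\<^sub>R x) = r *\<^sub>R (c *\<^sub>C (x::'a::complex_inner))"
  by (simp add: scaleR_scaleC scaleC_scaleC mult.commute)

lemma cinner_scaleC_left: "cinner (c *\<^sub>C x) y = cnj c * cinner (x::'a::complex_inner) y"
  by (metis cinner_commute cinner_scaleC_right complex_cnj_mult)

lemma norm_scaleC: "norm (c *\<^sub>C (x::'a::complex_inner)) = norm c * norm x"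
proof -
  have "inner (c *\<^sub>C x) (c *\<^sub>C x) = Re (c * cnj c * cinner x x)"
    by (simp add: inner_eq_Re_cinner cinner_scaleC_left cinner_scaleC_right mult.assoc mult.left_commute)
  also have "\<dots> = (norm c)\<^sup>2 * inner x x"
    by (simp add: inner_eq_Re_cinner complex_norm_square[symmetric] flip: of_real_power)
  finally have "(norm (c *\<^sub>C x))\<^sup>2 = (norm c * norm x)\<^sup>2"
    by (simp add: power2_norm_eq_inner power_mult_distrib)
  then show ?thesis
    by (simp add: power2_eq_iff_nonneg)
qed

lemma bounded_linear_scaleC: "bounded_linear (\<lambda>x::'a::complex_inner. c *\<^sub>C x)"
  by (rule bounded_linear_intro[of _ "norm c"])
     (simp_all add: scaleC_add_right scaleC_scaleR_commute norm_scaleC mult.commute)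

lemma Im_cinner: "Im (cinner x y) = inner x ((- \<i>) *\<^sub>C (y::'a::complex_inner))"
  unfolding inner_eq_Re_cinner cinner_scaleC_right by simp

lemma complex_linear_id [simp]: "complex_linear id_blinfun"
  and complex_linear_0 [simp]: "complex_linear 0"
  and complex_linear_add: "complex_linear A \<Longrightarrow> complex_linear B \<Longrightarrow> complex_linear (A + B)"
  and complex_linear_scaleR: "complex_linear A \<Longrightarrow> complex_linear (r *\<^sub>R A)"
  and complex_linear_compose: "complex_linear A \<Longrightarrow> complex_linear B \<Longrightarrow> complex_linear (A o\<^sub>L B)"
  by (auto simp: complex_linear_def blinfun.add_left blinfun.scaleR_left scaleC_add_right
      scaleC_scaleR_commute linear_0[OF bounded_linear.linear[OF bounded_linear_scaleC]])

lemma complex_linear_lim: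
  assumes "X \<longlonglongrightarrow> A" "\<And>k. complex_linear (X k)"
  shows "complex_linear A"
  unfolding complex_linear_def
proof (intro allI)
  fix c x
  have "(\<lambda>k. blinfun_apply (X k) (c *\<^sub>C x)) \<longlonglongrightarrow> blinfun_apply A (c *\<^sub>C x)"
    by (intro tendsto_intros assms)
  moreover have "(\<lambda>k. c *\<^sub>C blinfun_apply (X k) x) \<longlonglongrightarrow> c *\<^sub>C blinfun_apply A x"
    by (intro bounded_linear.tendsto[OF bounded_linear_scaleC] tendsto_intros assms)
  ultimately show "blinfun_apply A (c *\<^sub>C x) = c *\<^sub>C blinfun_apply A x"
    using assms(2) by (simp add: complex_linear_def LIMSEQ_unique)
qed

text \<open>Symmetry for the real inner product suffices, because \<open>Im \<langle>x, y\<rangle> = Re \<langle>x, - \<i> y\<rangle>\<close> and \<open>A\<close> commutes with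
multiplication by \<open>\<i>\<close>. From here on only the real inner product is used; complex linearity is carried
along as a closure property.\<close>

lemma selfadjoint_iff_inner:
  "selfadjoint A \<longleftrightarrow> complex_linear A \<and> (\<forall>x y. inner (blinfun_apply A x) y = inner x (blinfun_apply A y))"
proof safe
  assume A: "complex_linear A" and s: "\<forall>x y. inner (blinfun_apply A x) y = inner x (blinfun_apply A y)"
  show "selfadjoint A"
    unfolding selfadjoint_def
  proof (intro conjI allI A complex_eqI)
    fix x y
    show "Re (cinner (blinfun_apply A x) y) = Re (cinner x (blinfun_apply A y))"
      using s by (simp add: inner_eq_Re_cinner)
    show "Im (cinner (blinfun_apply A x) y) = Im (cinner x (blinfun_apply A y))"
      using s A by (simp only: Im_cinner complex_linear_def)
  qed
qed (auto simp: selfadjoint_def inner_eq_Re_cinner)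

lemma selfadjoint_inner: "selfadjoint A \<Longrightarrow> inner (blinfun_apply A x) y = inner x (blinfun_apply A y)"
  by (simp add: selfadjoint_iff_inner)

lemma selfadjoint_id [simp]: "selfadjoint id_blinfun"
  and selfadjoint_0 [simp]: "selfadjoint 0"
  and selfadjoint_add: "selfadjoint A \<Longrightarrow> selfadjoint B \<Longrightarrow> selfadjoint (A + B)"
  and selfadjoint_scaleR: "selfadjoint A \<Longrightarrow> selfadjoint (r *\<^sub>R A)"
  by (auto simp: selfadjoint_iff_inner complex_linear_add complex_linear_scaleR blinfun.add_left
      blinfun.scaleR_left inner_add_left inner_add_right)

lemma selfadjoint_diff: "selfadjoint A \<Longrightarrow> selfadjoint B \<Longrightarrow> selfadjoint (A - B)"
  using selfadjoint_add[of A "(-1) *\<^sub>R B"] selfadjoint_scaleR[of B "-1"] by simp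

lemma selfadjoint_sum: "(\<And>j. j \<in> I \<Longrightarrow> selfadjoint (X j)) \<Longrightarrow> selfadjoint (sum X I)"
  by (induction I rule: infinite_finite_induct) (auto intro: selfadjoint_add)

lemma selfadjoint_compose:
  assumes "selfadjoint A" "selfadjoint B" "A o\<^sub>L B = B o\<^sub>L A"
  shows "selfadjoint (A o\<^sub>L B)"
proof -
  have "inner (blinfun_apply A (blinfun_apply B x)) y = inner x (blinfun_apply A (blinfun_apply B y))" for x y
    using assms by (metis blinfun_apply_blinfun_compose selfadjoint_inner)
  then show ?thesis
    using assms by (simp add: selfadjoint_iff_inner complex_linear_compose)
qed

lemma selfadjoint_congruence:
  assumes "selfadjoint A" "selfadjoint B"
  shows "selfadjoint (A o\<^sub>L B o\<^sub>L A)"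
  using assms by (simp add: selfadjoint_iff_inner complex_linear_compose)

lemma selfadjoint_lim:
  assumes X: "X \<longlonglongrightarrow> A" and s: "\<And>k. selfadjoint (X k)"
  shows "selfadjoint A"
  unfolding selfadjoint_iff_inner
proof (intro conjI allI)
  show "complex_linear A"
    using complex_linear_lim[OF X] s by (simp add: selfadjoint_def)
  fix x y
  have "(\<lambda>k. inner (blinfun_apply (X k) x) y) \<longlonglongrightarrow> inner (blinfun_apply A x) y"
    by (intro tendsto_intros X)
  moreover have "(\<lambda>k. inner x (blinfun_apply (X k) y)) \<longlonglongrightarrow> inner x (blinfun_apply A y)"
    by (intro tendsto_intros X)
  ultimately show "inner (blinfun_apply A x) y = inner x (blinfun_apply A y)"
    using s by (simp add: selfadjoint_inner LIMSEQ_unique)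
qed

lemma loewner_le_iff:
  assumes "selfadjoint X" "selfadjoint Y"
  shows "loewner_le X Y \<longleftrightarrow> (\<forall>x. inner x (blinfun_apply X x) \<le> inner x (blinfun_apply Y x))"
  using selfadjoint_diff[OF assms(2,1)]
  by (simp add: loewner_le_def pos_semidef_def blinfun.diff_left inner_diff_right flip: inner_eq_Re_cinner)

text \<open>The order interval \<open>[a I, b I]\<close>, written through the quadratic form. It replaces the spectrum as the
domain of the functional calculus: a continuous function on \<open>{a..b}\<close> acts on every operator in the interval.\<close>

definition op_between :: "real \<Rightarrow> real \<Rightarrow> ('a::chilbert_space \<Rightarrow>\<^sub>L 'a) \<Rightarrow> bool"
  where "op_between a b A \<longleftrightarrow> selfadjoint A \<and>
    (\<forall>x. a * inner x x \<le> inner x (blinfun_apply A x) \<and> inner x (blinfun_apply A x) \<le> b * inner x x)"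

lemma op_between_selfadjoint: "op_between a b A \<Longrightarrow> selfadjoint A"
  by (simp add: op_between_def)

lemma op_between_mono: "op_between a b A \<Longrightarrow> c \<le> a \<Longrightarrow> b \<le> d \<Longrightarrow> op_between c d A"
  unfolding op_between_def by (meson inner_ge_zero mult_right_mono order_trans)

lemma abs_inner_blinfun_le: "\<bar>inner x (blinfun_apply A x)\<bar> \<le> norm A * inner x x"
proof -
  have "\<bar>inner x (blinfun_apply A x)\<bar> \<le> norm x * norm (blinfun_apply A x)"
    by (rule Cauchy_Schwarz_ineq2)
  also have "\<dots> \<le> norm x * (norm A * norm x)"
    by (intro mult_left_mono norm_blinfun) simp
  also have "\<dots> = norm A * inner x x"
    by (simp flip: power2_norm_eq_inner add: power2_eq_square)
  finally show ?thesis .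
qed

lemma op_between_norm: "selfadjoint A \<Longrightarrow> op_between (- norm A) (norm A) A"
  using abs_inner_blinfun_le[of _ A] unfolding op_between_def by (smt (verit) mult_minus_left)

text \<open>Polarization: \<open>4 \<langle>y, B x\<rangle> = q (x + y) - q (x - y)\<close> for the quadratic form \<open>q\<close> of \<open>B\<close>. With \<open>y\<close> a multiple of
\<open>B x\<close> of the same norm as \<open>x\<close>, the parallelogram law gives \<open>\<parallel>x\<parallel> \<parallel>B x\<parallel> \<le> s \<parallel>x\<parallel>\<^sup>2\<close>.\<close>

lemma norm_le_of_op_between:
  assumes B: "op_between (-s) s B" and s: "0 \<le> s"
  shows "norm B \<le> s"
proof (rule norm_blinfun_bound[OF s])
  fix x
  let ?y = "blinfun_apply B x"
  show "norm ?y \<le> s * norm x"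
  proof (cases "?y = 0 \<or> x = 0")
    case False
    define r where "r = norm x / norm ?y"
    have r: "r > 0" "r * norm ?y = norm x" using False by (auto simp: r_def)
    have sa: "inner (blinfun_apply B u) v = inner u (blinfun_apply B v)" for u v
      using B by (simp add: op_between_def selfadjoint_inner)
    let ?q = "\<lambda>u. inner u (blinfun_apply B u)"
    have "4 * (r * inner ?y ?y) = ?q (x + r *\<^sub>R ?y) - ?q (x - r *\<^sub>R ?y)"
      using sa[of x ?y]
      by (simp add: blinfun.add_right blinfun.diff_right blinfun.scaleR_right inner_add_left
          inner_add_right inner_diff_left inner_diff_right algebra_simps inner_commute)
    also have "\<dots> \<le> s * inner (x + r *\<^sub>R ?y) (x + r *\<^sub>R ?y) + s * inner (x - r *\<^sub>R ?y) (x - r *\<^sub>R ?y)"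
      using B unfolding op_between_def by (smt (verit) mult_minus_left)
    also have "\<dots> = 2 * s * (inner x x + r * r * inner ?y ?y)"
      by (simp add: inner_add_left inner_add_right inner_diff_left inner_diff_right algebra_simps)
    also have "r * r * inner ?y ?y = (norm x)\<^sup>2"
      unfolding r(2)[symmetric] by (simp add: power_mult_distrib power2_norm_eq_inner power2_eq_square[of r])
    finally have "4 * (r * inner ?y ?y) \<le> 4 * s * (norm x * norm x)"
      by (simp add: power2_norm_eq_inner[symmetric] power2_eq_square)
    then have "r * (norm ?y * norm ?y) \<le> s * (norm x * norm x)"
      by (simp add: dot_square_norm power2_eq_square)
    moreover have "r * (norm ?y * norm ?y) = norm x * norm ?y"
      using r(2) by (metis mult.assoc)
    ultimately have "norm x * norm ?y \<le> norm x * (s * norm x)" by (simp add: mult_ac)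
    then show ?thesis using False by simp
  qed (use s in auto)
qed

lemma selfadjoint_eqI:
  assumes "selfadjoint X" "selfadjoint Y"
    and "\<And>x. inner x (blinfun_apply X x) = inner x (blinfun_apply Y x)"
  shows "X = Y"
proof -
  have "op_between (-0) 0 (X - Y)"
    using assms by (simp add: op_between_def selfadjoint_diff blinfun.diff_left inner_diff_right)
  from norm_le_of_op_between[OF this] show ?thesis by simp
qed

text \<open>The form of \<open>P\<close> is nonnegative at \<open>x - s P x\<close>; the choice \<open>s = 1 / \<parallel>P\<parallel>\<close> gives the estimate.\<close>

lemma positive_op_norm_sq_le:
  assumes P: "selfadjoint P" and pos: "\<And>x. 0 \<le> inner x (blinfun_apply P x)"
  shows "inner (blinfun_apply P x) (blinfun_apply P x) \<le> norm P * inner x (blinfun_apply P x)"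
proof (cases "norm P = 0")
  case False
  let ?y = "blinfun_apply P x" and ?s = "1 / norm P"
  have "0 \<le> inner (x - ?s *\<^sub>R ?y) (blinfun_apply P (x - ?s *\<^sub>R ?y))"
    by (rule pos)
  also have "\<dots> = inner x ?y - 2 * ?s * inner ?y ?y + ?s * ?s * inner ?y (blinfun_apply P ?y)"
    using selfadjoint_inner[OF P, of x ?y]
    by (simp add: blinfun.diff_right blinfun.scaleR_right inner_diff_left inner_diff_right
        inner_commute algebra_simps)
  also have "\<dots> \<le> inner x ?y - 2 * ?s * inner ?y ?y + ?s * ?s * (norm P * inner ?y ?y)"
    using abs_inner_blinfun_le[of ?y P] by (intro add_left_mono mult_left_mono) auto
  finally show ?thesis using False by (simp add: field_simps)
qed simp

lemma blinfun_compose_assoc: "(A o\<^sub>L B) o\<^sub>L C = A o\<^sub>L (B o\<^sub>L C)"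
  and blinfun_compose_id_left [simp]: "id_blinfun o\<^sub>L A = A"
  and blinfun_compose_id_right [simp]: "A o\<^sub>L id_blinfun = A"
  by (auto intro!: blinfun_eqI)

lemmas blinfun_compose_left_simps =
  bounded_bilinear.add_left[OF bounded_bilinear_blinfun_compose]
  bounded_bilinear.diff_left[OF bounded_bilinear_blinfun_compose]
  bounded_bilinear.scaleR_left[OF bounded_bilinear_blinfun_compose]

lemmas blinfun_compose_right_simps =
  bounded_bilinear.add_right[OF bounded_bilinear_blinfun_compose]
  bounded_bilinear.diff_right[OF bounded_bilinear_blinfun_compose]
  bounded_bilinear.scaleR_right[OF bounded_bilinear_blinfun_compose]

lemmas blinfun_compose_simps = blinfun_compose_left_simps blinfun_compose_right_simps

section \<open>Invertible operators\<close>

lemma op_invertibleI: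
  assumes "A o\<^sub>L B = id_blinfun" "C o\<^sub>L A = id_blinfun"
  shows "op_invertible A"
proof -
  have "C = C o\<^sub>L (A o\<^sub>L B)" using assms by simp
  also have "\<dots> = B" using assms(2) by (simp add: blinfun_compose_assoc[symmetric])
  finally show ?thesis using assms unfolding op_invertible_def by blast
qed

lemma op_invertible_compose:
  assumes "op_invertible A" "op_invertible B" shows "op_invertible (A o\<^sub>L B)"
proof -
  obtain A' B' where "A o\<^sub>L A' = id_blinfun" "A' o\<^sub>L A = id_blinfun" "B o\<^sub>L B' = id_blinfun" "B' o\<^sub>L B = id_blinfun"
    using assms unfolding op_invertible_def by blast
  then have "(A o\<^sub>L B) o\<^sub>L (B' o\<^sub>L A') = id_blinfun" "(B' o\<^sub>L A') o\<^sub>L (A o\<^sub>L B) = id_blinfun"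
    by (metis blinfun_compose_assoc blinfun_compose_id_left)+
  then show ?thesis unfolding op_invertible_def by blast
qed

lemma op_invertible_scaleR:
  assumes "op_invertible A" "r \<noteq> 0" shows "op_invertible (r *\<^sub>R A)"
proof -
  obtain B where "A o\<^sub>L B = id_blinfun" "B o\<^sub>L A = id_blinfun"
    using assms unfolding op_invertible_def by blast
  with \<open>r \<noteq> 0\<close> have "(r *\<^sub>R A) o\<^sub>L (inverse r *\<^sub>R B) = id_blinfun" "(inverse r *\<^sub>R B) o\<^sub>L (r *\<^sub>R A) = id_blinfun"
    by (simp_all add: blinfun_compose_simps)
  then show ?thesis by (rule op_invertibleI)
qed

lemma op_inverse_eqI:
  assumes "A o\<^sub>L B = id_blinfun" "B o\<^sub>L A = id_blinfun"
  shows "op_inverse A = B"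
  unfolding op_inverse_def
proof (rule the_equality)
  fix C assume "A o\<^sub>L C = id_blinfun \<and> C o\<^sub>L A = id_blinfun"
  with assms(1) show "C = B"
    by (metis blinfun_compose_assoc blinfun_compose_id_left blinfun_compose_id_right)
qed (use assms in auto)

lemma neumann_series:
  fixes T :: "'a::chilbert_space \<Rightarrow>\<^sub>L 'a"
  assumes T: "norm T < 1" shows "op_invertible (id_blinfun - T)"
proof -
  let ?P = "\<lambda>k. ((o\<^sub>L) T ^^ k) id_blinfun"
  have n: "norm (?P k) \<le> norm T ^ k" for k
  proof (induction k)
    case 0 then show ?case by (simp add: norm_blinfun_id_le)
  next
    case (Suc k)
    have "norm (?P (Suc k)) \<le> norm T * norm (?P k)" by (simp add: norm_blinfun_compose)
    also have "\<dots> \<le> norm T * norm T ^ k" by (intro mult_left_mono Suc) simp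
    finally show ?case by simp
  qed
  have comm: "?P k o\<^sub>L T = ?P (Suc k)" for k
    by (induction k) (simp_all add: blinfun_compose_assoc)
  have "summable ?P"
    by (rule summable_comparison_test'[OF summable_geometric[of "norm T"]]) (use T n in auto)
  then have S: "?P sums suminf ?P" by (rule summable_sums)
  let ?S = "suminf ?P"
  have S1: "(\<lambda>k. ?P (Suc k)) sums (?S - id_blinfun)"
    using S by (subst sums_Suc_iff) simp
  have "(\<lambda>k. T o\<^sub>L ?P k) sums (T o\<^sub>L ?S)"
    by (rule bounded_linear.sums[OF bounded_bilinear.bounded_linear_right[OF bounded_bilinear_blinfun_compose] S])
  then have 1: "T o\<^sub>L ?S = ?S - id_blinfun" using sums_unique2[OF S1] by simp
  have "(\<lambda>k. ?P k o\<^sub>L T) sums (?S o\<^sub>L T)"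
    by (rule bounded_linear.sums[OF bounded_bilinear.bounded_linear_left[OF bounded_bilinear_blinfun_compose] S])
  then have 2: "?S o\<^sub>L T = ?S - id_blinfun" unfolding comm using sums_unique2[OF S1] by simp
  show ?thesis
    by (rule op_invertibleI[of _ ?S ?S])
       (simp_all add: blinfun_compose_simps 1 2)
qed

text \<open>For \<open>0 < c I \<le> B \<le> K I\<close> the operator \<open>I - B / K\<close> lies between \<open>0\<close> and \<open>1 - c / K < 1\<close>, so the Neumann series
inverts \<open>B / K\<close>.\<close>

lemma op_between_invertible:
  assumes B: "op_between c M B" and c: "c > 0"
  shows "op_invertible B"
proof -
  define K where "K = max M (max c 1)"
  have K: "K \<ge> c" "K > 0" by (auto simp: K_def)
  have B': "op_between c K B" by (rule op_between_mono[OF B]) (auto simp: K_def)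
  let ?s = "1 - c / K"
  have s: "0 \<le> ?s" "?s < 1" using c K by (auto simp: field_simps)
  have "op_between (- ?s) ?s (id_blinfun - (1/K) *\<^sub>R B)"
    unfolding op_between_def
  proof (intro conjI allI)
    show "selfadjoint (id_blinfun - (1/K) *\<^sub>R B)"
      using B by (simp add: op_between_def selfadjoint_diff selfadjoint_scaleR)
    fix x
    have q: "c * inner x x \<le> inner x (blinfun_apply B x)" "inner x (blinfun_apply B x) \<le> K * inner x x"
      using B' by (auto simp: op_between_def)
    have e: "inner x (blinfun_apply (id_blinfun - (1/K) *\<^sub>R B) x) = inner x x - inner x (blinfun_apply B x) / K"
      by (simp add: blinfun.diff_left blinfun.scaleR_left inner_diff_right)
    have "inner x (blinfun_apply B x) / K \<le> inner x x" using q K by (simp add: field_simps)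
    then have "0 \<le> inner x (blinfun_apply (id_blinfun - (1/K) *\<^sub>R B) x)" unfolding e by simp
    moreover have "- ?s * inner x x \<le> 0" using s by (intro mult_nonpos_nonneg) auto
    ultimately show "- ?s * inner x x \<le> inner x (blinfun_apply (id_blinfun - (1/K) *\<^sub>R B) x)" by linarith
    have "c * inner x x / K \<le> inner x (blinfun_apply B x) / K" using q K by (intro divide_right_mono) auto
    then show "inner x (blinfun_apply (id_blinfun - (1/K) *\<^sub>R B) x) \<le> ?s * inner x x"
      unfolding e by (simp add: algebra_simps)
  qed
  then have "norm (id_blinfun - (1/K) *\<^sub>R B) < 1"
    using norm_le_of_op_between s by fastforce
  from neumann_series[OF this] have "op_invertible ((1/K) *\<^sub>R B)" by simp
  from op_invertible_scaleR[OF this, of K] K show ?thesis by simp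
qed

text \<open>If \<open>Q P = I\<close>, then \<open>\<parallel>x\<parallel>\<^sup>2 \<le> \<parallel>Q\<parallel>\<^sup>2 \<parallel>P x\<parallel>\<^sup>2\<close>, and for positive \<open>P\<close> the right-hand side is controlled by
\<open>\<langle>x, P x\<rangle>\<close>. The added ones only keep the constant positive.\<close>

lemma positive_invertible_bounded_below:
  assumes P: "selfadjoint P" and pos: "\<And>x. 0 \<le> inner x (blinfun_apply P x)" and inv: "op_invertible P"
  shows "\<exists>c>0. \<forall>x. c * inner x x \<le> inner x (blinfun_apply P x)"
proof -
  obtain Q where Q: "Q o\<^sub>L P = id_blinfun" using inv unfolding op_invertible_def by blast
  let ?k = "(norm Q + 1)\<^sup>2 * (norm P + 1)"
  have k: "?k > 0" by (intro mult_pos_pos zero_less_power add_nonneg_pos) auto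
  have "inner x x \<le> ?k * inner x (blinfun_apply P x)" for x
  proof -
    have "norm x = norm (blinfun_apply Q (blinfun_apply P x))" using Q
      by (metis blinfun_apply_blinfun_compose blinfun_apply_id_blinfun id_apply)
    also have "\<dots> \<le> norm Q * norm (blinfun_apply P x)" by (rule norm_blinfun)
    also have "\<dots> \<le> (norm Q + 1) * norm (blinfun_apply P x)" by (intro mult_right_mono) auto
    finally have "(norm x)\<^sup>2 \<le> ((norm Q + 1) * norm (blinfun_apply P x))\<^sup>2" by (intro power_mono) auto
    also have "\<dots> = (norm Q + 1)\<^sup>2 * inner (blinfun_apply P x) (blinfun_apply P x)"
      by (simp add: power_mult_distrib power2_norm_eq_inner)
    also have "\<dots> \<le> (norm Q + 1)\<^sup>2 * (norm P * inner x (blinfun_apply P x))"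
      by (intro mult_left_mono positive_op_norm_sq_le[OF P pos]) auto
    also have "\<dots> \<le> (norm Q + 1)\<^sup>2 * ((norm P + 1) * inner x (blinfun_apply P x))"
      using pos[of x] by (intro mult_left_mono mult_right_mono) auto
    finally show ?thesis by (simp add: power2_norm_eq_inner mult.assoc)
  qed
  then have "1 / ?k * inner x x \<le> inner x (blinfun_apply P x)" for x
    using k by (simp add: pos_divide_le_eq mult.commute)
  then show ?thesis using k by (intro exI[of _ "1 / ?k"]) auto
qed

lemma PD_iff: "A \<in> PD \<longleftrightarrow> (\<exists>c>0. \<exists>M. op_between c M A)"
proof
  assume "A \<in> PD"
  then have s: "selfadjoint A" and pos: "\<And>x. 0 \<le> inner x (blinfun_apply A x)" and i: "op_invertible A"
    by (auto simp: PD_def pos_semidef_def inner_eq_Re_cinner)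
  obtain c where c: "c > 0" "\<And>x. c * inner x x \<le> inner x (blinfun_apply A x)"
    using positive_invertible_bounded_below[OF s pos i] by blast
  have "op_between c (norm A) A"
    using s c op_between_norm[OF s] by (simp add: op_between_def)
  with c show "\<exists>c>0. \<exists>M. op_between c M A" by blast
next
  assume "\<exists>c>0. \<exists>M. op_between c M A"
  then obtain c M where c: "c > 0" "op_between c M A" by blast
  have "0 \<le> inner x (blinfun_apply A x)" for x
    using c unfolding op_between_def by (meson inner_ge_zero less_imp_le mult_nonneg_nonneg order_trans)
  with c op_between_invertible[OF c(2,1)] show "A \<in> PD"
    by (auto simp: PD_def pos_semidef_def op_between_def inner_eq_Re_cinner)
qed

text \<open>Otherwise \<open>\<parallel>B\<parallel>\<^sup>2 I - B\<^sup>2 = - (B - \<parallel>B\<parallel> I) (B + \<parallel>B\<parallel> I)\<close> would be positive and invertible, hence at least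
\<open>c I\<close> for some \<open>c > 0\<close>; but then \<open>\<parallel>B x\<parallel>\<^sup>2 \<le> (\<parallel>B\<parallel>\<^sup>2 - c) \<parallel>x\<parallel>\<^sup>2\<close>, against the definition of the operator norm.\<close>

lemma norm_in_spectrum:
  assumes B: "selfadjoint B" and n: "norm B > 0"
  shows "norm B \<in> op_spectrum B \<or> - norm B \<in> op_spectrum B"
proof (rule ccontr)
  assume "\<not> ?thesis"
  then have "op_invertible (B - norm B *\<^sub>R id_blinfun)" "op_invertible (B - (- norm B) *\<^sub>R id_blinfun)"
    by (auto simp: op_spectrum_def)
  then have "op_invertible ((-1) *\<^sub>R ((B - norm B *\<^sub>R id_blinfun) o\<^sub>L (B - (- norm B) *\<^sub>R id_blinfun)))"
    by (intro op_invertible_scaleR op_invertible_compose) auto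
  also have "(-1) *\<^sub>R ((B - norm B *\<^sub>R id_blinfun) o\<^sub>L (B - (- norm B) *\<^sub>R id_blinfun)) =
      ((norm B)\<^sup>2 *\<^sub>R id_blinfun - (B o\<^sub>L B))" (is "_ = ?P")
    by (simp add: blinfun_compose_simps algebra_simps power2_eq_square)
  finally have inv: "op_invertible ?P" .
  have s: "selfadjoint ?P"
    using B by (intro selfadjoint_diff selfadjoint_scaleR selfadjoint_compose) auto
  have q: "inner x (blinfun_apply ?P x) = (norm B)\<^sup>2 * inner x x - (norm (blinfun_apply B x))\<^sup>2" for x
    using selfadjoint_inner[OF B, of x "blinfun_apply B x"]
    by (simp add: blinfun.diff_left blinfun.scaleR_left inner_diff_right power2_norm_eq_inner)
  have "0 \<le> inner x (blinfun_apply ?P x)" for x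
    unfolding q using power_mono[OF norm_blinfun[of B x], of 2]
    by (simp add: power_mult_distrib power2_norm_eq_inner)
  then obtain c where c: "c > 0" "\<And>x. c * inner x x \<le> inner x (blinfun_apply ?P x)"
    using positive_invertible_bounded_below[OF s _ inv] by blast
  let ?b = "sqrt (max 0 ((norm B)\<^sup>2 - c))"
  have "norm B \<le> ?b"
  proof (rule norm_blinfun_bound)
    fix x
    have "(norm (blinfun_apply B x))\<^sup>2 \<le> ((norm B)\<^sup>2 - c) * inner x x"
      using c(2)[of x] unfolding q by (simp add: algebra_simps)
    also have "\<dots> \<le> max 0 ((norm B)\<^sup>2 - c) * inner x x" by (intro mult_right_mono) auto
    also have "\<dots> = (?b * norm x)\<^sup>2" by (simp add: power_mult_distrib power2_norm_eq_inner)
    finally show "norm (blinfun_apply B x) \<le> ?b * norm x"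
      by (rule power2_le_imp_le) simp
  qed simp
  then have "(norm B)\<^sup>2 \<le> ?b\<^sup>2" by (intro power_mono) auto
  then show False using c n by (auto simp: max_def split: if_splits)
qed

section \<open>Polynomials of an operator\<close>

lemma poly_op_altdef:
  assumes "degree q \<le> n"
  shows "poly_op q A = (\<Sum>i\<le>n. coeff q i *\<^sub>R (((o\<^sub>L) A ^^ i) id_blinfun))"
  unfolding poly_op_def
  by (rule sum.mono_neutral_left) (use assms in \<open>auto simp: coeff_eq_0\<close>)

lemma poly_op_0 [simp]: "poly_op 0 A = 0"
  by (simp add: poly_op_def)

lemma poly_op_pCons [simp]: "poly_op (pCons a p) A = a *\<^sub>R id_blinfun + (A o\<^sub>L poly_op p A)"
proof -
  have "poly_op (pCons a p) A = (\<Sum>i\<le>Suc (degree p). coeff (pCons a p) i *\<^sub>R (((o\<^sub>L) A ^^ i) id_blinfun))"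
    by (rule poly_op_altdef) (rule degree_pCons_le)
  also have "\<dots> = a *\<^sub>R id_blinfun + (\<Sum>i\<le>degree p. coeff p i *\<^sub>R (A o\<^sub>L (((o\<^sub>L) A ^^ i) id_blinfun)))"
    by (subst sum.atMost_Suc_shift) simp
  also have "(\<Sum>i\<le>degree p. coeff p i *\<^sub>R (A o\<^sub>L (((o\<^sub>L) A ^^ i) id_blinfun))) = A o\<^sub>L poly_op p A"
    unfolding poly_op_def
    by (simp add: bounded_bilinear.sum_right[OF bounded_bilinear_blinfun_compose] blinfun_compose_simps)
  finally show ?thesis .
qed

lemma poly_op_add: "poly_op (p + q) A = poly_op p A + poly_op q A"
proof -
  let ?n = "max (degree p) (degree q)"
  have "degree (p + q) \<le> ?n" by (simp add: degree_add_le)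
  then show ?thesis
    using poly_op_altdef[of p ?n A] poly_op_altdef[of q ?n A] poly_op_altdef[of "p + q" ?n A]
    by (simp add: scaleR_add_left sum.distrib)
qed

lemma poly_op_smult: "poly_op (smult c p) A = c *\<^sub>R poly_op p A"
  by (induction p) (simp_all add: blinfun_compose_simps scaleR_add_right)

lemma poly_op_diff: "poly_op (p - q) A = poly_op p A - poly_op q A"
  using poly_op_add[of p "- q" A] poly_op_smult[of "-1" q A] by simp

lemma poly_op_mult: "poly_op (p * q) A = poly_op p A o\<^sub>L poly_op q A"
  by (induction p) (simp_all add: poly_op_add poly_op_smult blinfun_compose_simps blinfun_compose_assoc)

lemma poly_op_commute: "poly_op p A o\<^sub>L poly_op q A = poly_op q A o\<^sub>L poly_op p A"
  by (metis poly_op_mult mult.commute)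

lemma poly_op_X: "poly_op [:0, 1:] A = A"
  by simp

lemma selfadjoint_poly_op: "selfadjoint A \<Longrightarrow> selfadjoint (poly_op p A)"
proof (induction p)
  case (pCons a p)
  have "A o\<^sub>L poly_op p A = poly_op p A o\<^sub>L A"
    using poly_op_commute[of "[:0, 1:]" A p] by simp
  then show ?case using pCons by (simp add: selfadjoint_add selfadjoint_scaleR selfadjoint_compose)
qed simp

lemma continuous_on_poly_op: "continuous_on S (\<lambda>A. poly_op p A)"
  by (induction p)
    (auto intro!: continuous_intros bounded_bilinear.continuous_on[OF bounded_bilinear_blinfun_compose])

section \<open>Spectral mapping for real polynomials\<close>

lemma poly_map_poly_of_real_mult_add:
  "poly (map_poly complex_of_real (p * q + r)) z =
     poly (map_poly of_real p) z * poly (map_poly of_real q) z + poly (map_poly of_real r) z"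
proof -
  have add: "poly (map_poly complex_of_real (p + q)) z = poly (map_poly of_real p) z + poly (map_poly of_real q) z"
    for p q by (induction p q rule: poly_induct2) (simp_all add: map_poly_pCons algebra_simps)
  have smult: "poly (map_poly complex_of_real (smult c p)) z = of_real c * poly (map_poly of_real p) z" for c p
    by (induction p) (simp_all add: map_poly_pCons algebra_simps)
  have "poly (map_poly complex_of_real (p * q)) z = poly (map_poly of_real p) z * poly (map_poly of_real q) z"
    by (induction p) (simp_all add: map_poly_pCons add smult algebra_simps)
  then show ?thesis by (simp add: add)
qed

text \<open>A non-real complex root \<open>a + \<i> b\<close> makes the real quadratic \<open>(x - a)\<^sup>2 + b\<^sup>2\<close> a divisor: the remainder is linear
with real coefficients and vanishes at a non-real point. The quadratic is written as a sum of squares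
because \<open>(A - a I)\<^sup>2 + b\<^sup>2 I \<ge> b\<^sup>2 I\<close> is visibly invertible.\<close>

lemma real_poly_factor:
  fixes r :: "real poly"
  assumes "degree r > 0"
  shows "(\<exists>a s. r = [:-a, 1:] * s) \<or> (\<exists>a b s. b \<noteq> 0 \<and> r = ([:-a, 1:] * [:-a, 1:] + [:b * b:]) * s)"
proof -
  let ?e = "\<lambda>p z. poly (map_poly complex_of_real p) z"
  have "\<not> constant (poly (map_poly complex_of_real r))"
    using assms by (simp add: constant_degree degree_map_poly)
  then obtain z where z: "?e r z = 0" using fundamental_theorem_of_algebra by blast
  show ?thesis
  proof (cases "Im z = 0")
    case True
    then have "z = of_real (Re z)" by (simp add: complex_eq_iff)
    have "?e p (of_real x) = of_real (poly p x)" for p and x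
      by (induction p) (simp_all add: map_poly_pCons)
    then have "poly r (Re z) = 0" using z \<open>z = _\<close> by (metis of_real_eq_0_iff)
    then have "[:- Re z, 1:] dvd r" by (simp add: poly_eq_0_iff_dvd)
    then obtain s where "r = [:- Re z, 1:] * s" by (rule dvdE)
    then show ?thesis by blast
  next
    case False
    define a b where "a = Re z" and "b = Im z"
    have zab: "z = Complex a b" by (simp add: a_def b_def)
    let ?q = "[:-a, 1:] * [:-a, 1:] + [:b * b:]"
    have q: "?q = [:a * a + b * b, - 2 * a, 1:]" by simp
    have eq: "?e ?q z = 0"
      unfolding q by (simp add: map_poly_pCons zab complex_eq_iff algebra_simps)
    have "?q \<noteq> 0" "degree ?q = 2" unfolding q by auto
    then have "degree (r mod ?q) < 2"
      using degree_mod_less[of ?q r] by (cases "r mod ?q = 0") auto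
    then have "r mod ?q = [:coeff (r mod ?q) 0, coeff (r mod ?q) 1:]"
      by (intro poly_eqI) (auto simp: coeff_pCons coeff_eq_0 split: nat.split)
    then obtain m0 m1 where m: "r mod ?q = [:m0, m1:]" by blast
    have rq: "r = ?q * (r div ?q) + [:m0, m1:]"
      unfolding m[symmetric] by (rule mult_div_mod_eq[symmetric])
    have "?e r z = ?e ?q z * ?e (r div ?q) z + ?e [:m0, m1:] z"
      by (rule trans[OF arg_cong[OF rq, of "\<lambda>p. ?e p z"] poly_map_poly_of_real_mult_add])
    then have "?e [:m0, m1:] z = 0" unfolding z eq by simp
    then have e0: "complex_of_real m0 + z * complex_of_real m1 = 0"
      by (simp add: map_poly_pCons)
    have "Im z * m1 = 0" using arg_cong[OF e0, of Im] by simp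
    then have "m1 = 0" using False by simp
    with e0 have "m0 = 0" by simp
    then have "[:m0, m1:] = 0" using \<open>m1 = 0\<close> by simp
    have "r = ?q * (r div ?q)"
      by (rule rq[unfolded \<open>[:m0, m1:] = 0\<close> add_0_right])
    moreover have "b \<noteq> 0" using False b_def by simp
    ultimately show ?thesis by (intro disjI2 exI conjI)
  qed
qed

lemma poly_op_invertible:
  assumes A: "selfadjoint A"
  shows "r \<noteq> 0 \<Longrightarrow> (\<And>x. x \<in> op_spectrum A \<Longrightarrow> poly r x \<noteq> 0) \<Longrightarrow> op_invertible (poly_op r A)"
proof (induction "degree r" arbitrary: r rule: less_induct)
  case less
  show ?case
  proof (cases "degree r = 0")
    case True
    then obtain c where "r = [:c:]" by (rule degree_eq_zeroE)
    then show ?thesis using less.prems(1) op_invertible_scaleR[of id_blinfun c]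
      by (auto simp: op_invertible_def intro!: exI[of _ id_blinfun])
  next
    case False
    have IH: "op_invertible (poly_op s A)" if r: "r = q * s" and q: "degree q > 0" for q s
    proof (rule less.hyps)
      have "s \<noteq> 0" "q \<noteq> 0" using r less.prems(1) by auto
      then show "degree s < degree r" "s \<noteq> 0" using q unfolding r by (simp_all add: degree_mult_eq)
      show "poly s x \<noteq> 0" if "x \<in> op_spectrum A" for x using less.prems(2)[OF that] unfolding r by simp
    qed
    from real_poly_factor[of r] False consider
      a s where "r = [:-a, 1:] * s" | a b s where "b \<noteq> 0" "r = ([:-a, 1:] * [:-a, 1:] + [:b * b:]) * s" by blast
    then show ?thesis
    proof cases
      case 1
      have "a \<notin> op_spectrum A" using less.prems(2)[of a] 1 by auto
      then have "op_invertible (poly_op [:-a, 1:] A)" by (simp add: op_spectrum_def)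
      moreover have "op_invertible (poly_op s A)" using IH[OF 1] by simp
      ultimately show ?thesis unfolding 1 poly_op_mult by (rule op_invertible_compose)
    next
      case 2
      let ?q = "[:-a, 1:] * [:-a, 1:] + [:b * b:]"
      let ?L = "poly_op [:-a, 1:] A" and ?Q = "poly_op ?q A"
      have saL: "selfadjoint ?L" and saQ: "selfadjoint ?Q" by (rule selfadjoint_poly_op[OF A])+
      have Q: "?Q = (?L o\<^sub>L ?L) + (b * b) *\<^sub>R id_blinfun"
        by (simp only: poly_op_add poly_op_mult) simp
      have "inner x (blinfun_apply ?Q x) = inner (blinfun_apply ?L x) (blinfun_apply ?L x) + b * b * inner x x" for x
        unfolding Q by (simp add: blinfun.add_left blinfun.scaleR_left inner_add_right
          selfadjoint_inner[OF saL] del: poly_op_pCons)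
      then have "b * b * inner x x \<le> inner x (blinfun_apply ?Q x)" for x by simp
      then have "op_between (b * b) (norm ?Q) ?Q"
        using op_between_norm[OF saQ] saQ unfolding op_between_def by blast
      then have "op_invertible ?Q"
        using op_between_invertible 2(1) by (metis not_real_square_gt_zero)
      moreover have "op_invertible (poly_op s A)" by (rule IH[OF 2(2)]) simp
      ultimately show ?thesis unfolding 2(2) poly_op_mult by (rule op_invertible_compose)
    qed
  qed
qed

text \<open>If \<open>m\<close> is not a value of \<open>q\<close> on the spectrum, then \<open>q - m\<close> has no root there, so \<open>q(A) - m I\<close> is invertible.
The exception is \<open>q = m\<close> with an empty spectrum, which happens only on the zero space, where every
operator is invertible.\<close>

lemma spectrum_poly_op_subset:
  assumes A: "selfadjoint A" and m: "m \<in> op_spectrum (poly_op q A)"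
  shows "m \<in> poly q ` op_spectrum A"
proof (rule ccontr)
  assume no: "m \<notin> poly q ` op_spectrum A"
  let ?r = "q - [:m:]"
  have e: "poly_op ?r A = poly_op q A - m *\<^sub>R id_blinfun" by (simp add: poly_op_diff)
  have ni: "\<not> op_invertible (poly_op ?r A)" using m unfolding e by (simp add: op_spectrum_def)
  have "?r = 0"
    using ni poly_op_invertible[OF A, of ?r] no by (auto simp: image_iff)
  then have "op_spectrum A = {}" using no by auto
  have "id_blinfun = (0 :: 'a \<Rightarrow>\<^sub>L 'a)"
  proof (cases "norm A = 0")
    case True
    then have "op_invertible (0 :: 'a \<Rightarrow>\<^sub>L 'a)"
      using \<open>op_spectrum A = {}\<close> by (auto simp: op_spectrum_def dest!: spec[of _ 0])
    then show ?thesis by (auto simp: op_invertible_def)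
  next
    case False
    then show ?thesis using norm_in_spectrum[OF A] \<open>op_spectrum A = {}\<close> by auto
  qed
  then have "x = y" for x y :: 'a
    by (metis blinfun_apply_id_blinfun id_apply zero_blinfun.rep_eq)
  then have "op_invertible (poly_op ?r A)"
    by (intro op_invertibleI[of _ 0 0]) (auto intro!: blinfun_eqI)
  with ni show False ..
qed

text \<open>The norm of the self-adjoint operator \<open>q(A)\<close> is, up to sign, in its spectrum, hence a value of \<open>q\<close> on the
spectrum of \<open>A\<close>. This is the estimate that makes the functional calculus well defined.\<close>

lemma norm_poly_op_le:
  assumes A: "selfadjoint A" and s: "\<And>x. x \<in> op_spectrum A \<Longrightarrow> \<bar>poly q x\<bar> \<le> s" and "0 \<le> s"
  shows "norm (poly_op q A) \<le> s"
proof (rule ccontr)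
  let ?b = "norm (poly_op q A)"
  assume "\<not> ?thesis"
  then have b: "?b > s" "?b > 0" using \<open>0 \<le> s\<close> by auto
  from norm_in_spectrum[OF selfadjoint_poly_op[OF A] b(2)]
  have "?b \<in> poly q ` op_spectrum A \<or> - ?b \<in> poly q ` op_spectrum A"
    by (auto dest: spectrum_poly_op_subset[OF A])
  then obtain x where "x \<in> op_spectrum A" "\<bar>poly q x\<bar> = ?b"
    by (metis abs_minus_cancel abs_norm_cancel imageE)
  with s[of x] b show False by auto
qed

lemma op_spectrum_subset:
  assumes A: "op_between a b A"
  shows "op_spectrum A \<subseteq> {a..b}"
proof
  fix x assume x: "x \<in> op_spectrum A"
  have sa: "selfadjoint (A - x *\<^sub>R id_blinfun)"
    using A by (simp add: op_between_def selfadjoint_diff selfadjoint_scaleR)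
  have sh: "op_between (a - x) (b - x) (A - x *\<^sub>R id_blinfun)"
    using A sa by (simp add: op_between_def blinfun.diff_left blinfun.scaleR_left inner_diff_right algebra_simps)
  have sh': "op_between (x - b) (x - a) ((-1) *\<^sub>R (A - x *\<^sub>R id_blinfun))"
    using A selfadjoint_scaleR[OF sa, of "-1"]
    by (simp add: op_between_def blinfun.diff_left blinfun.scaleR_left inner_diff_right algebra_simps blinfun.minus_left)
  have ni: "\<not> op_invertible (A - x *\<^sub>R id_blinfun)" using x by (simp add: op_spectrum_def)
  have "\<not> a - x > 0" using op_between_invertible[OF sh] ni by blast
  moreover have "\<not> x - b > 0"
    using op_between_invertible[OF sh'] op_invertible_scaleR[of "(-1) *\<^sub>R (A - x *\<^sub>R id_blinfun)" "-1"] ni by fastforce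
  ultimately show "x \<in> {a..b}" by auto
qed

section \<open>Continuous functional calculus\<close>

lemma Weierstrass_poly:
  fixes f :: "real \<Rightarrow> real"
  assumes "continuous_on {a..b} f"
  shows "\<exists>q :: nat \<Rightarrow> real poly. uniform_limit {a..b} (\<lambda>k. poly (q k)) f sequentially"
proof -
  have "\<exists>q. \<forall>x\<in>{a..b}. \<bar>f x - poly q x\<bar> < 1 / real (Suc k)" for k
  proof -
    obtain g where g: "polynomial_function g" "\<And>x. x \<in> {a..b} \<Longrightarrow> norm (f x - g x) < 1 / real (Suc k)"
      using Stone_Weierstrass_polynomial_function[OF compact_Icc assms, of "1 / real (Suc k)"] by auto
    then have "real_polynomial_function g" by (simp add: real_polynomial_function_eq)
    then obtain c n where c: "g = (\<lambda>x. \<Sum>i\<le>n. c i * x ^ i)"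
      by (auto simp: real_polynomial_function_iff_sum)
    have "poly (\<Sum>i\<le>n. monom (c i) i) x = g x" for x
      by (simp add: c poly_sum poly_monom)
    then show ?thesis using g(2) by (metis real_norm_def)
  qed
  then obtain q where q: "\<And>k x. x \<in> {a..b} \<Longrightarrow> \<bar>f x - poly (q k) x\<bar> < 1 / real (Suc k)"
    by metis
  have "uniform_limit {a..b} (\<lambda>k. poly (q k)) f sequentially"
    unfolding uniform_limit_sequentially_iff
  proof (intro allI impI)
    fix e :: real assume "e > 0"
    then obtain N where N: "1 / real (Suc N) < e" by (meson nat_approx_posE)
    show "\<exists>N. \<forall>n\<ge>N. \<forall>x\<in>{a..b}. dist (poly (q n) x) (f x) < e"
    proof (intro exI allI impI ballI)
      fix n x assume "N \<le> n" "x \<in> {a..b}"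
      then have "\<bar>f x - poly (q n) x\<bar> < 1 / real (Suc n)" "1 / real (Suc n) \<le> 1 / real (Suc N)"
        using q by (auto simp: frac_le)
      then show "dist (poly (q n) x) (f x) < e" using N by (simp add: dist_real_def abs_minus_commute)
    qed
  qed
  then show ?thesis by blast
qed

lemma poly_op_near:
  assumes A: "selfadjoint A" and "0 \<le> d" "0 \<le> e"
    and "\<And>x. x \<in> op_spectrum A \<Longrightarrow> dist (poly p x) (f x) \<le> d"
    and "\<And>x. x \<in> op_spectrum A \<Longrightarrow> dist (poly q x) (f x) \<le> e"
  shows "dist (poly_op p A) (poly_op q A) \<le> d + e"
proof -
  have "norm (poly_op (p - q) A) \<le> d + e"
  proof (rule norm_poly_op_le[OF A])
    fix x assume "x \<in> op_spectrum A"
    with assms(4)[OF this] assms(5)[OF this] show "\<bar>poly (p - q) x\<bar> \<le> d + e"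
      by (simp add: dist_real_def)
  qed (use assms in simp)
  then show ?thesis by (simp add: poly_op_diff dist_norm)
qed

text \<open>The defining property of \<open>cfc f A\<close> speaks of all polynomial sequences converging on the spectrum; one such
sequence exists, and by the norm estimate for polynomials all of them have the same limit. Afterwards
any sequence converging on the larger set \<open>{a..b}\<close> computes \<open>cfc f A\<close>.\<close>

lemma cfc_limit:
  assumes A: "op_between a b A" and f: "continuous_on {a..b} f"
    and q: "uniform_limit {a..b} (\<lambda>k. poly (q k)) f sequentially"
  shows "(\<lambda>k. poly_op (q k) A) \<longlonglongrightarrow> cfc f A"
proof -
  have sa: "selfadjoint A" by (rule op_between_selfadjoint[OF A])
  let ?S = "op_spectrum A"
  have S: "?S \<subseteq> {a..b}" by (rule op_spectrum_subset[OF A])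
  have q': "uniform_limit ?S (\<lambda>k. poly (q k)) f sequentially"
    by (rule uniform_limit_on_subset[OF q S])
  have "Cauchy (\<lambda>k. poly_op (q k) A)"
    unfolding Cauchy_def
  proof (intro allI impI)
    fix e :: real assume "e > 0"
    then obtain N where "\<forall>n\<ge>N. \<forall>x\<in>?S. dist (poly (q n) x) (f x) < e / 3"
      using q'[unfolded uniform_limit_sequentially_iff, rule_format, of "e/3"] by auto
    then have "dist (poly_op (q m) A) (poly_op (q n) A) \<le> e / 3 + e / 3" if "m \<ge> N" "n \<ge> N" for m n
      using that \<open>e > 0\<close> by (intro poly_op_near[OF sa, where f = f]) (auto intro: less_imp_le)
    then show "\<exists>M. \<forall>m\<ge>M. \<forall>n\<ge>M. dist (poly_op (q m) A) (poly_op (q n) A) < e"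
      using \<open>e > 0\<close> by (intro exI[of _ N]) force
  qed
  then obtain B where B: "(\<lambda>k. poly_op (q k) A) \<longlonglongrightarrow> B"
    using Cauchy_convergent convergent_def by blast
  have r: "(\<lambda>k. poly_op (r k) A) \<longlonglongrightarrow> B"
    if r: "uniform_limit ?S (\<lambda>k. poly (r k)) f sequentially" for r
  proof (rule Lim_transform[OF B], rule tendstoI)
    fix e :: real assume "e > 0"
    then have e: "e / 3 > 0" by simp
    have "eventually (\<lambda>n. (\<forall>x\<in>?S. dist (poly (q n) x) (f x) < e / 3) \<and> (\<forall>x\<in>?S. dist (poly (r n) x) (f x) < e / 3)) sequentially"
      using uniform_limitD[OF q' e] uniform_limitD[OF r e] by (rule eventually_conj)
    then show "eventually (\<lambda>n. dist (poly_op (r n) A - poly_op (q n) A) 0 < e) sequentially"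
    proof eventually_elim
      case (elim n)
      then have "dist (poly_op (r n) A) (poly_op (q n) A) \<le> e / 3 + e / 3"
        using e by (intro poly_op_near[OF sa, where f = f]) (auto intro: less_imp_le)
      then show ?case using \<open>e > 0\<close> by (simp add: dist_norm)
    qed
  qed
  have "cfc f A = B"
    unfolding cfc_def
  proof (rule the_equality)
    fix C assume "\<forall>q. uniform_limit ?S (\<lambda>k. poly (q k)) f sequentially \<longrightarrow> (\<lambda>k. poly_op (q k) A) \<longlonglongrightarrow> C"
    with q' have "(\<lambda>k. poly_op (q k) A) \<longlonglongrightarrow> C" by blast
    then show "C = B" by (rule LIMSEQ_unique[OF _ B])
  qed (use r in blast)
  with B show ?thesis by simp
qed

lemma selfadjoint_cfc:
  assumes A: "op_between a b A" and f: "continuous_on {a..b} f"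
  shows "selfadjoint (cfc f A)"
proof -
  obtain q where "uniform_limit {a..b} (\<lambda>k. poly (q k)) f sequentially"
    using Weierstrass_poly[OF f] by blast
  from cfc_limit[OF A f this] show ?thesis
    by (rule selfadjoint_lim) (rule selfadjoint_poly_op[OF op_between_selfadjoint[OF A]])
qed

lemma cfc_poly:
  assumes A: "op_between a b A"
  shows "cfc (poly q) A = poly_op q A"
  using cfc_limit[OF A, of "poly q" "\<lambda>_. q"]
  by (simp add: uniform_limit_const continuous_intros LIMSEQ_const_iff)

lemma poly_eq_fun:
  "poly [:c:] = (\<lambda>x. c)" "poly [:0, 1:] = (\<lambda>x::real. x)"
  "poly (p + q) = (\<lambda>x. poly p x + poly q x)" "poly (p * q) = (\<lambda>x. poly p x * poly q x)"
  for c :: real and p q :: "real poly"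
  by (simp_all add: fun_eq_iff)

lemma cfc_const: "op_between a b A \<Longrightarrow> cfc (\<lambda>x. c) A = c *\<^sub>R id_blinfun"
  using cfc_poly[of a b A "[:c:]"] by (simp only: poly_eq_fun) simp

lemma cfc_id: "op_between a b A \<Longrightarrow> cfc (\<lambda>x. x) A = A"
  using cfc_poly[of a b A "[:0, 1:]"] by (simp only: poly_eq_fun poly_op_X)

lemma cfc_cong:
  assumes A: "op_between a b A" and f: "continuous_on {a..b} f"
    and eq: "\<And>x. x \<in> {a..b} \<Longrightarrow> f x = g x"
  shows "cfc f A = cfc g A"
proof -
  obtain q where q: "uniform_limit {a..b} (\<lambda>k. poly (q k)) f sequentially"
    using Weierstrass_poly[OF f] by blast
  then have "uniform_limit {a..b} (\<lambda>k. poly (q k)) g sequentially"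
    by (rule uniform_limit_cong'[THEN iffD1, rotated 2]) (use eq in auto)
  moreover have "continuous_on {a..b} g"
    using f continuous_on_cong[of "{a..b}" "{a..b}" f g] eq by simp
  ultimately show ?thesis
    using cfc_limit[OF A] cfc_limit[OF A f q] LIMSEQ_unique by blast
qed

lemma cfc_add:
  assumes A: "op_between a b A" and f: "continuous_on {a..b} f" and g: "continuous_on {a..b} g"
  shows "cfc (\<lambda>x. f x + g x) A = cfc f A + cfc g A"
proof -
  obtain p where p: "uniform_limit {a..b} (\<lambda>k. poly (p k)) f sequentially"
    using Weierstrass_poly[OF f] by blast
  obtain q where q: "uniform_limit {a..b} (\<lambda>k. poly (q k)) g sequentially"
    using Weierstrass_poly[OF g] by blast
  have "uniform_limit {a..b} (\<lambda>k. poly (p k + q k)) (\<lambda>x. f x + g x) sequentially"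
    using uniform_limit_add[OF p q] by (simp only: poly_eq_fun)
  from cfc_limit[OF A continuous_on_add[OF f g] this]
  have "(\<lambda>k. poly_op (p k) A + poly_op (q k) A) \<longlonglongrightarrow> cfc (\<lambda>x. f x + g x) A"
    by (simp add: poly_op_add)
  then show ?thesis
    using tendsto_add[OF cfc_limit[OF A f p] cfc_limit[OF A g q]] by (rule LIMSEQ_unique)
qed

lemma cfc_mult:
  assumes A: "op_between a b A" and f: "continuous_on {a..b} f" and g: "continuous_on {a..b} g"
  shows "cfc (\<lambda>x. f x * g x) A = cfc f A o\<^sub>L cfc g A"
proof -
  obtain p where p: "uniform_limit {a..b} (\<lambda>k. poly (p k)) f sequentially"
    using Weierstrass_poly[OF f] by blast
  obtain q where q: "uniform_limit {a..b} (\<lambda>k. poly (q k)) g sequentially"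
    using Weierstrass_poly[OF g] by blast
  have bd: "bounded (f ` {a..b})" "bounded (g ` {a..b})"
    using f g by (auto intro!: compact_imp_bounded compact_continuous_image)
  have "uniform_limit {a..b} (\<lambda>k. poly (p k * q k)) (\<lambda>x. f x * g x) sequentially"
    using uniform_lim_mult[OF p q bd] by (simp only: poly_eq_fun)
  from cfc_limit[OF A continuous_on_mult[OF f g] this]
  have "(\<lambda>k. poly_op (p k) A o\<^sub>L poly_op (q k) A) \<longlonglongrightarrow> cfc (\<lambda>x. f x * g x) A"
    by (simp add: poly_op_mult)
  then show ?thesis
    using bounded_bilinear.tendsto[OF bounded_bilinear_blinfun_compose cfc_limit[OF A f p] cfc_limit[OF A g q]]
    by (rule LIMSEQ_unique)
qed

lemma cfc_scale:
  assumes A: "op_between a b A" and f: "continuous_on {a..b} f"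
  shows "cfc (\<lambda>x. c * f x) A = c *\<^sub>R cfc f A"
  using cfc_mult[OF A _ f, of "\<lambda>_. c"] by (simp add: cfc_const[OF A] blinfun_compose_simps)

lemma cfc_diff:
  assumes A: "op_between a b A" and f: "continuous_on {a..b} f" and g: "continuous_on {a..b} g"
  shows "cfc (\<lambda>x. f x - g x) A = cfc f A - cfc g A"
  using cfc_add[OF A f, of "\<lambda>x. (-1) * g x"] cfc_scale[OF A g, of "-1"] g
  by (simp add: continuous_intros)

text \<open>A nonnegative \<open>f\<close> is the square of \<open>sqrt f\<close>, so \<open>f(A)\<close> is the square of a self-adjoint operator.\<close>

lemma cfc_nonneg:
  assumes A: "op_between a b A" and f: "continuous_on {a..b} f" and pos: "\<And>x. x \<in> {a..b} \<Longrightarrow> 0 \<le> f x"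
  shows "0 \<le> inner x (blinfun_apply (cfc f A) x)"
proof -
  let ?h = "\<lambda>x. sqrt (f x)"
  have h: "continuous_on {a..b} ?h" using f by (intro continuous_intros)
  have "cfc f A = cfc (\<lambda>x. ?h x * ?h x) A"
    by (rule cfc_cong[OF A f]) (use pos in simp)
  also have "\<dots> = cfc ?h A o\<^sub>L cfc ?h A" by (rule cfc_mult[OF A h h])
  finally show ?thesis
    using selfadjoint_inner[OF selfadjoint_cfc[OF A h], of x "blinfun_apply (cfc ?h A) x", symmetric]
    by simp
qed

lemma cfc_mono:
  assumes A: "op_between a b A" and f: "continuous_on {a..b} f" and g: "continuous_on {a..b} g"
    and le: "\<And>x. x \<in> {a..b} \<Longrightarrow> f x \<le> g x"
  shows "inner x (blinfun_apply (cfc f A) x) \<le> inner x (blinfun_apply (cfc g A) x)"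
  using cfc_nonneg[OF A continuous_on_diff[OF g f], of x] le
  by (simp add: cfc_diff[OF A g f] blinfun.diff_left inner_diff_right)

lemma cfc_between:
  assumes A: "op_between a b A" and f: "continuous_on {a..b} f"
    and "\<And>x. x \<in> {a..b} \<Longrightarrow> f x \<in> {m..M}"
  shows "op_between m M (cfc f A)"
  unfolding op_between_def
  using selfadjoint_cfc[OF A f] cfc_mono[OF A continuous_on_const f, of m]
    cfc_mono[OF A f continuous_on_const, of M] assms(3)
  by (auto simp: cfc_const[OF A] blinfun.scaleR_left)

lemma norm_cfc_le:
  assumes A: "op_between a b A" and f: "continuous_on {a..b} f"
    and "\<And>x. x \<in> {a..b} \<Longrightarrow> \<bar>f x\<bar> \<le> s" and "0 \<le> s"
  shows "norm (cfc f A) \<le> s"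
  using assms(3) by (intro norm_le_of_op_between[OF cfc_between[OF A f] \<open>0 \<le> s\<close>]) (force simp: abs_le_iff)

lemma norm_cfc_diff_le:
  assumes A: "op_between a b A" and f: "continuous_on {a..b} f" and g: "continuous_on {a..b} g"
    and "\<And>x. x \<in> {a..b} \<Longrightarrow> \<bar>f x - g x\<bar> \<le> s" and "0 \<le> s"
  shows "norm (cfc f A - cfc g A) \<le> s"
  using norm_cfc_le[OF A continuous_on_diff[OF f g] assms(4,5)] by (simp add: cfc_diff[OF A f g])

text \<open>The identity holds for polynomials \<open>g\<close> because \<open>cfc\<close> is multiplicative, and passes to uniform limits.\<close>

lemma cfc_compose:
  assumes A: "op_between a b A" and f: "continuous_on {a..b} f"
    and fg: "\<And>x. x \<in> {a..b} \<Longrightarrow> f x \<in> {c..d}" and g: "continuous_on {c..d} g"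
  shows "cfc g (cfc f A) = cfc (\<lambda>x. g (f x)) A"
proof -
  have fA: "op_between c d (cfc f A)" by (rule cfc_between[OF A f fg])
  have gf: "continuous_on {a..b} (\<lambda>x. g (f x))"
    by (rule continuous_on_compose2[OF g f]) (use fg in blast)
  obtain q where q: "uniform_limit {c..d} (\<lambda>k. poly (q k)) g sequentially"
    using Weierstrass_poly[OF g] by blast
  have pf: "continuous_on {a..b} (\<lambda>x. poly p (f x))" for p
    by (intro continuous_intros f)
  have poly: "poly_op p (cfc f A) = cfc (\<lambda>x. poly p (f x)) A" for p
  proof (induction p)
    case 0
    then show ?case using cfc_const[OF A, of 0] by simp
  next
    case (pCons k p)
    then show ?case
      using cfc_add[OF A continuous_on_const continuous_on_mult[OF f pf], of k p] cfc_mult[OF A f pf, of p]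
      by (simp add: cfc_const[OF A])
  qed
  have "(\<lambda>k. poly_op (q k) (cfc f A)) \<longlonglongrightarrow> cfc (\<lambda>x. g (f x)) A"
  proof (rule tendstoI)
    fix e :: real assume "e > 0"
    then have "e / 2 > 0" by simp
    from uniform_limitD[OF q this]
    show "eventually (\<lambda>k. dist (poly_op (q k) (cfc f A)) (cfc (\<lambda>x. g (f x)) A) < e) sequentially"
    proof eventually_elim
      case (elim k)
      have "norm (poly_op (q k) (cfc f A) - cfc (\<lambda>x. g (f x)) A) \<le> e / 2"
        unfolding poly
        by (rule norm_cfc_diff_le[OF A pf gf])
           (use elim fg \<open>e > 0\<close> in \<open>auto simp: dist_real_def intro: less_imp_le\<close>)
      then show ?case using \<open>e > 0\<close> by (simp add: dist_norm)
    qed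
  qed
  with cfc_limit[OF fA g q] show ?thesis by (rule LIMSEQ_unique)
qed

lemma continuous_on_cfc:
  assumes f: "continuous_on {a..b} f"
  shows "continuous_on {A :: 'a::chilbert_space \<Rightarrow>\<^sub>L 'a. op_between a b A} (cfc f)"
proof -
  obtain q where q: "uniform_limit {a..b} (\<lambda>k. poly (q k)) f sequentially"
    using Weierstrass_poly[OF f] by blast
  have "uniform_limit {A :: 'a \<Rightarrow>\<^sub>L 'a. op_between a b A} (\<lambda>k. poly_op (q k)) (cfc f) sequentially"
  proof (rule uniform_limitI)
    fix e :: real assume "e > 0"
    then have "e / 2 > 0" by simp
    from uniform_limitD[OF q this]
    show "\<forall>\<^sub>F k in sequentially. \<forall>A\<in>{A :: 'a \<Rightarrow>\<^sub>L 'a. op_between a b A}. dist (poly_op (q k) A) (cfc f A) < e"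
    proof eventually_elim
      case (elim k)
      show ?case
      proof
        fix A :: "'a \<Rightarrow>\<^sub>L 'a"
        assume "A \<in> {A. op_between a b A}"
        then have A: "op_between a b A" by simp
        have "norm (cfc (poly (q k)) A - cfc f A) \<le> e / 2"
          by (rule norm_cfc_diff_le[OF A _ f])
             (use elim \<open>e > 0\<close> in \<open>auto simp: dist_real_def intro: less_imp_le continuous_intros\<close>)
        then show "dist (poly_op (q k) A) (cfc f A) < e"
          using \<open>e > 0\<close> by (simp add: dist_norm cfc_poly[OF A])
      qed
    qed
  qed
  then show ?thesis
    by (rule uniform_limit_theorem[OF always_eventually[OF allI[OF continuous_on_poly_op]]]) simp
qed

lemma op_between_near_scalar:
  assumes "selfadjoint A"
  shows "op_between (c - norm (A - c *\<^sub>R id_blinfun)) (c + norm (A - c *\<^sub>R id_blinfun)) A"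
proof -
  have "op_between (- norm (A - c *\<^sub>R id_blinfun)) (norm (A - c *\<^sub>R id_blinfun)) (A - c *\<^sub>R id_blinfun)"
    using assms by (intro op_between_norm selfadjoint_diff selfadjoint_scaleR) auto
  then show ?thesis
    using assms by (simp add: op_between_def blinfun.diff_left blinfun.scaleR_left inner_diff_right algebra_simps)
qed

lemma cfc_scalar:
  assumes "continuous_on {c..c} f"
  shows "cfc f (c *\<^sub>R id_blinfun) = f c *\<^sub>R id_blinfun"
proof -
  have b: "op_between c c (c *\<^sub>R id_blinfun)"
    by (simp add: op_between_def selfadjoint_scaleR blinfun.scaleR_left)
  have "cfc f (c *\<^sub>R id_blinfun) = cfc (\<lambda>_. f c) (c *\<^sub>R id_blinfun)"
    by (rule cfc_cong[OF b]) auto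
  also have "\<dots> = f c *\<^sub>R id_blinfun" by (rule cfc_const[OF b])
  finally show ?thesis .
qed

text \<open>At a scalar operator the derivative of the functional calculus is the scalar derivative, although it is
complicated elsewhere: every self-adjoint \<open>Y\<close> with \<open>\<parallel>Y - c I\<parallel> = h\<close> lies between \<open>c - h\<close> and \<open>c + h\<close>, so the
operator remainder is bounded by the scalar remainder on that interval. The derivative is taken within
the self-adjoint operators, the only ones on which \<open>cfc\<close> is meaningful.\<close>

lemma cfc_has_derivative_scalar:
  assumes r: "r > 0" and f: "continuous_on {c - r..c + r} f" and D: "(f has_real_derivative d) (at c)"
  shows "(cfc f has_derivative (\<lambda>K. d *\<^sub>R K))
    (at (c *\<^sub>R id_blinfun) within {A :: 'a::chilbert_space \<Rightarrow>\<^sub>L 'a. selfadjoint A})"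
  unfolding has_derivative_within_alt
proof (intro conjI allI impI)
  fix e :: real assume e: "e > 0"
  have "(f has_derivative (*) d) (at c)" using D by (simp add: has_field_derivative_def)
  then obtain s where s: "s > 0" "\<And>x. \<bar>x - c\<bar> < s \<Longrightarrow> \<bar>f x - f c - d * (x - c)\<bar> \<le> e * \<bar>x - c\<bar>"
    unfolding has_derivative_within_alt using e by (auto simp: real_norm_def)
  show "\<exists>h>0. \<forall>Y\<in>{A :: 'a \<Rightarrow>\<^sub>L 'a. selfadjoint A}. norm (Y - c *\<^sub>R id_blinfun) < h \<longrightarrow>
      norm (cfc f Y - cfc f (c *\<^sub>R id_blinfun) - d *\<^sub>R (Y - c *\<^sub>R id_blinfun)) \<le> e * norm (Y - c *\<^sub>R id_blinfun)"
  proof (intro exI[of _ "min r s"] conjI ballI impI)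
    fix Y :: "'a \<Rightarrow>\<^sub>L 'a"
    let ?h = "norm (Y - c *\<^sub>R id_blinfun)"
    assume "Y \<in> {A. selfadjoint A}" and h: "?h < min r s"
    then have Y: "op_between (c - ?h) (c + ?h) Y" by (auto intro: op_between_near_scalar)
    have cf: "continuous_on {c - ?h..c + ?h} f" using h by (intro continuous_on_subset[OF f]) auto
    have cl: "continuous_on {c - ?h..c + ?h} (\<lambda>x. f c + d * (x - c))" by (intro continuous_intros)
    have "cfc (\<lambda>x. f c + d * (x - c)) Y = f c *\<^sub>R id_blinfun + d *\<^sub>R (Y - c *\<^sub>R id_blinfun)"
      by (simp add: cfc_add[OF Y] cfc_scale[OF Y] cfc_diff[OF Y] cfc_const[OF Y] cfc_id[OF Y] continuous_intros)
    moreover have "cfc f (c *\<^sub>R id_blinfun :: 'a \<Rightarrow>\<^sub>L 'a) = f c *\<^sub>R id_blinfun" by (rule cfc_scalar) simp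
    ultimately have "norm (cfc f Y - cfc f (c *\<^sub>R id_blinfun) - d *\<^sub>R (Y - c *\<^sub>R id_blinfun))
        = norm (cfc f Y - cfc (\<lambda>x. f c + d * (x - c)) Y)" by (simp only: diff_diff_eq)
    also have "\<dots> \<le> e * ?h"
    proof (rule norm_cfc_diff_le[OF Y cf cl])
      fix x assume "x \<in> {c - ?h..c + ?h}"
      then have x: "\<bar>x - c\<bar> \<le> ?h" by auto
      with h have "\<bar>f x - f c - d * (x - c)\<bar> \<le> e * \<bar>x - c\<bar>" by (intro s) auto
      also have "\<dots> \<le> e * ?h" using x e by (intro mult_left_mono) auto
      finally show "\<bar>f x - (f c + d * (x - c))\<bar> \<le> e * ?h" by (simp add: algebra_simps)
    qed (use e in simp)
    finally show "norm (cfc f Y - cfc f (c *\<^sub>R id_blinfun) - d *\<^sub>R (Y - c *\<^sub>R id_blinfun)) \<le> e * ?h" .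
  qed (use r s in auto)
qed (rule bounded_linear_scaleR_right)

section \<open>The Loewner order\<close>

lemma pos_semidef_iff: "pos_semidef A \<longleftrightarrow> selfadjoint A \<and> (\<forall>x. 0 \<le> inner x (blinfun_apply A x))"
  by (simp add: pos_semidef_def inner_eq_Re_cinner)

lemma pos_semidef_0 [simp]: "pos_semidef 0"
  and pos_semidef_add: "pos_semidef A \<Longrightarrow> pos_semidef B \<Longrightarrow> pos_semidef (A + B)"
  and pos_semidef_scaleR: "0 \<le> r \<Longrightarrow> pos_semidef A \<Longrightarrow> pos_semidef (r *\<^sub>R A)"
  by (auto simp: pos_semidef_iff selfadjoint_add selfadjoint_scaleR blinfun.add_left
      blinfun.scaleR_left inner_add_right)

lemma pos_semidef_congruence:
  assumes "pos_semidef A" "selfadjoint C"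
  shows "pos_semidef (C o\<^sub>L A o\<^sub>L C)"
proof -
  have "inner x (blinfun_apply (C o\<^sub>L A o\<^sub>L C) x) = inner (blinfun_apply C x) (blinfun_apply A (blinfun_apply C x))" for x
    using assms(2) by (simp add: selfadjoint_inner)
  then show ?thesis using assms by (simp add: pos_semidef_iff selfadjoint_congruence)
qed

lemma closed_pos_semidef: "closed {A. pos_semidef A}"
proof -
  have "pos_semidef A" if X: "\<And>k. pos_semidef (X k)" and l: "X \<longlonglongrightarrow> A" for X and A :: "'a \<Rightarrow>\<^sub>L 'a"
    unfolding pos_semidef_iff
  proof (intro conjI allI)
    show "selfadjoint A" using selfadjoint_lim[OF l] X by (simp add: pos_semidef_iff)
    fix x
    have "(\<lambda>k. inner x (blinfun_apply (X k) x)) \<longlonglongrightarrow> inner x (blinfun_apply A x)"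
      by (intro tendsto_intros l)
    then show "0 \<le> inner x (blinfun_apply A x)"
      by (rule LIMSEQ_le_const) (use X in \<open>auto simp: pos_semidef_iff\<close>)
  qed
  then show ?thesis by (auto simp: closed_sequential_limits)
qed

lemma loewner_le_refl [simp]: "loewner_le X X"
  by (simp add: loewner_le_def)

lemma loewner_le_trans [trans]: "loewner_le X Y \<Longrightarrow> loewner_le Y Z \<Longrightarrow> loewner_le X Z"
  unfolding loewner_le_def using pos_semidef_add[of "Y - X" "Z - Y"] by simp

lemma loewner_le_antisym:
  assumes "loewner_le X Y" "loewner_le Y X" shows "X = Y"
proof -
  have s: "selfadjoint (Y - X)" "\<And>x. 0 \<le> inner x (blinfun_apply (Y - X) x)" "\<And>x. 0 \<le> inner x (blinfun_apply (X - Y) x)"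
    using assms by (auto simp: loewner_le_def pos_semidef_iff)
  have "Y - X = 0"
    by (rule selfadjoint_eqI)
       (use s in \<open>auto simp: blinfun.diff_left inner_diff_right intro: order_antisym\<close>)
  then show ?thesis by simp
qed

lemma loewner_le_add: "loewner_le X Y \<Longrightarrow> loewner_le X' Y' \<Longrightarrow> loewner_le (X + X') (Y + Y')"
  unfolding loewner_le_def using pos_semidef_add[of "Y - X" "Y' - X'"] by (simp add: algebra_simps)

lemma loewner_le_scaleR: "0 \<le> r \<Longrightarrow> loewner_le X Y \<Longrightarrow> loewner_le (r *\<^sub>R X) (r *\<^sub>R Y)"
  unfolding loewner_le_def using pos_semidef_scaleR[of r "Y - X"] by (simp add: algebra_simps)

lemma loewner_le_scaleR_left:
  "r \<le> s \<Longrightarrow> pos_semidef X \<Longrightarrow> loewner_le (r *\<^sub>R X) (s *\<^sub>R X)"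
  unfolding loewner_le_def using pos_semidef_scaleR[of "s - r" X] by (simp add: algebra_simps)

lemma loewner_le_sum: "(\<And>j. j \<in> I \<Longrightarrow> loewner_le (X j) (Y j)) \<Longrightarrow> loewner_le (sum X I) (sum Y I)"
  by (induction I rule: infinite_finite_induct) (auto intro: loewner_le_add)

lemma loewner_le_congruence:
  "loewner_le X Y \<Longrightarrow> selfadjoint C \<Longrightarrow> loewner_le (C o\<^sub>L X o\<^sub>L C) (C o\<^sub>L Y o\<^sub>L C)"
  unfolding loewner_le_def using pos_semidef_congruence[of "Y - X" C] by (simp add: blinfun_compose_simps)

lemma loewner_le_tendsto:
  assumes "(X \<longlongrightarrow> A) F" "(Y \<longlongrightarrow> B) F" "\<forall>\<^sub>F k in F. loewner_le (X k) (Y k)" "F \<noteq> bot"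
  shows "loewner_le A B"
proof -
  have "B - A \<in> {A. pos_semidef A}"
    by (rule Lim_in_closed_set[OF closed_pos_semidef _ assms(4) tendsto_diff[OF assms(2,1)]])
       (use assms(3) in \<open>simp add: loewner_le_def\<close>)
  then show ?thesis by (simp add: loewner_le_def)
qed

lemma op_between_loewner:
  "op_between a b A \<longleftrightarrow> loewner_le (a *\<^sub>R id_blinfun) A \<and> loewner_le A (b *\<^sub>R id_blinfun)"
proof -
  have "selfadjoint A" if "selfadjoint (A - a *\<^sub>R id_blinfun)"
    using selfadjoint_add[OF that selfadjoint_scaleR[OF selfadjoint_id, of a]] by simp
  then show ?thesis
    by (auto simp: op_between_def loewner_le_def pos_semidef_iff selfadjoint_diff selfadjoint_scaleR
        blinfun.diff_left blinfun.scaleR_left inner_diff_right)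
qed

section \<open>The cone of positive invertible operators\<close>

lemma PD_obtain_bounds:
  assumes "A \<in> PD" obtains a b where "0 < a" "op_between a b A"
  using assms PD_iff by blast

lemma op_between_PD: "op_between a b A \<Longrightarrow> 0 < a \<Longrightarrow> A \<in> PD"
  using PD_iff by blast

lemma PD_selfadjoint: "A \<in> PD \<Longrightarrow> selfadjoint A"
  and PD_pos_semidef: "A \<in> PD \<Longrightarrow> pos_semidef A"
  by (auto simp: PD_def pos_semidef_def)

lemma PD_scaleR:
  assumes A: "A \<in> PD" and c: "c > 0" shows "c *\<^sub>R A \<in> PD"
proof -
  obtain a b where "0 < a" and ab: "op_between a b A" using A by (rule PD_obtain_bounds)
  then have "op_between (c * a) (c * b) (c *\<^sub>R A)"
    using c by (auto simp: op_between_def selfadjoint_scaleR blinfun.scaleR_left mult.assoc)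
  with \<open>0 < a\<close> c show ?thesis by (auto intro: op_between_PD)
qed

lemma PD_mono:
  assumes X: "X \<in> PD" and XY: "loewner_le X Y" shows "Y \<in> PD"
proof -
  obtain a b where a: "0 < a" and "op_between a b X" using X by (rule PD_obtain_bounds)
  then have aX: "loewner_le (a *\<^sub>R id_blinfun) X" by (simp add: op_between_loewner)
  have sY: "selfadjoint Y"
    using XY PD_selfadjoint[OF X] selfadjoint_add[of "Y - X" X] by (simp add: loewner_le_def pos_semidef_iff)
  have "loewner_le Y (norm Y *\<^sub>R id_blinfun)"
    using op_between_norm[OF sY] by (simp add: op_between_loewner)
  with loewner_le_trans[OF aX XY] a show ?thesis by (auto simp: op_between_loewner intro: op_between_PD)
qed

lemma PD_add: "X \<in> PD \<Longrightarrow> pos_semidef Y \<Longrightarrow> X + Y \<in> PD"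
  by (rule PD_mono[of X]) (simp_all add: loewner_le_def)

lemma PD_congruence:
  assumes X: "X \<in> PD" and C: "selfadjoint C" "op_invertible C"
  shows "C o\<^sub>L X o\<^sub>L C \<in> PD"
  using pos_semidef_congruence[OF PD_pos_semidef[OF X] C(1)] op_invertible_compose C(2) X
  by (auto simp: PD_def)

lemma continuous_pos_bounds:
  fixes f :: "real \<Rightarrow> real"
  assumes "continuous_on {a..b} f" "\<And>x. x \<in> {a..b} \<Longrightarrow> 0 < f x"
  obtains m M where "0 < m" "\<And>x. x \<in> {a..b} \<Longrightarrow> f x \<in> {m..M}"
proof (cases "a \<le> b")
  case True
  obtain u where u: "u \<in> {a..b}" "\<And>x. x \<in> {a..b} \<Longrightarrow> f u \<le> f x"
    using continuous_attains_inf[OF _ _ assms(1)] True by auto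
  obtain v where v: "v \<in> {a..b}" "\<And>x. x \<in> {a..b} \<Longrightarrow> f x \<le> f v"
    using continuous_attains_sup[OF _ _ assms(1)] True by auto
  show ?thesis by (rule that[of "f u" "f v"]) (use u v assms(2) in auto)
qed (rule that[of 1 1], auto)

lemma cfc_PD:
  assumes A: "op_between a b A" and f: "continuous_on {a..b} f" "\<And>x. x \<in> {a..b} \<Longrightarrow> 0 < f x"
  shows "cfc f A \<in> PD"
proof -
  obtain m M where "0 < m" "\<And>x. x \<in> {a..b} \<Longrightarrow> f x \<in> {m..M}"
    using continuous_pos_bounds[OF f] by blast
  then show ?thesis using cfc_between[OF A f(1)] by (auto intro: op_between_PD)
qed

lemma cfc_compose_pos:
  assumes A: "op_between a b A" and f: "continuous_on {a..b} f" "\<And>x. x \<in> {a..b} \<Longrightarrow> 0 < f x"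
    and g: "continuous_on {0<..} g"
  shows "cfc g (cfc f A) = cfc (\<lambda>x. g (f x)) A"
proof -
  obtain m M where m: "0 < m" "\<And>x. x \<in> {a..b} \<Longrightarrow> f x \<in> {m..M}"
    using continuous_pos_bounds[OF f] by blast
  have "continuous_on {m..M} g" using m(1) by (intro continuous_on_subset[OF g]) auto
  from cfc_compose[OF A f(1) m(2) this] show ?thesis by simp
qed

lemma continuous_on_powr_pos: "continuous_on {0<..} (\<lambda>x::real. x powr r)"
  by (intro continuous_intros) auto

lemma continuous_on_ln_pos: "continuous_on {0<..} (ln :: real \<Rightarrow> real)"
  by (intro continuous_intros) auto

lemma continuous_on_Icc_powr: "0 < a \<Longrightarrow> continuous_on {a..b} (\<lambda>x::real. x powr r)"
  by (rule continuous_on_subset[OF continuous_on_powr_pos]) auto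

lemma op_powr_cfc:
  assumes "op_between a b A" "continuous_on {a..b} f" "\<And>x. x \<in> {a..b} \<Longrightarrow> 0 < f x"
  shows "op_powr (cfc f A) r = cfc (\<lambda>x. f x powr r) A"
  unfolding op_powr_def by (rule cfc_compose_pos[OF assms continuous_on_powr_pos])

lemma op_powr_PD: "A \<in> PD \<Longrightarrow> op_powr A r \<in> PD"
  unfolding op_powr_def
  by (erule PD_obtain_bounds) (auto intro!: cfc_PD continuous_on_Icc_powr)

lemma op_powr_selfadjoint: "A \<in> PD \<Longrightarrow> selfadjoint (op_powr A r)"
  by (intro PD_selfadjoint op_powr_PD)

lemma op_powr_add:
  assumes "A \<in> PD" shows "op_powr A r o\<^sub>L op_powr A s = op_powr A (r + s)"
proof -
  obtain a b where a: "0 < a" and A: "op_between a b A" using assms by (rule PD_obtain_bounds)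
  show ?thesis
    unfolding op_powr_def powr_add
    by (rule cfc_mult[OF A, symmetric]) (rule continuous_on_Icc_powr[OF a])+
qed

lemma op_powr_0:
  assumes "A \<in> PD" shows "op_powr A 0 = id_blinfun"
proof -
  obtain a b where a: "0 < a" and A: "op_between a b A" using assms by (rule PD_obtain_bounds)
  have "cfc (\<lambda>x. x powr 0) A = cfc (\<lambda>x. 1) A"
    by (rule cfc_cong[OF A continuous_on_Icc_powr[OF a]]) (use a in auto)
  then show ?thesis unfolding op_powr_def using cfc_const[OF A, of 1] by simp
qed

lemma op_powr_1:
  assumes "A \<in> PD" shows "op_powr A 1 = A"
proof -
  obtain a b where a: "0 < a" and A: "op_between a b A" using assms by (rule PD_obtain_bounds)
  have "cfc (\<lambda>x. x powr 1) A = cfc (\<lambda>x. x) A"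
    by (rule cfc_cong[OF A continuous_on_Icc_powr[OF a]]) (use a in auto)
  then show ?thesis unfolding op_powr_def using cfc_id[OF A] by simp
qed

lemma op_powr_scaleR:
  assumes "A \<in> PD" and c: "c > 0" shows "op_powr (c *\<^sub>R A) r = c powr r *\<^sub>R op_powr A r"
proof -
  obtain a b where a: "0 < a" and A: "op_between a b A" using assms(1) by (rule PD_obtain_bounds)
  have "op_powr (cfc (\<lambda>x. c * x) A) r = cfc (\<lambda>x. (c * x) powr r) A"
    by (rule op_powr_cfc[OF A]) (use a c in \<open>auto intro!: continuous_intros\<close>)
  also have "\<dots> = cfc (\<lambda>x. c powr r * x powr r) A"
    by (rule cfc_cong[OF A]) (use a c in \<open>auto intro!: continuous_intros simp: powr_mult\<close>)
  also have "\<dots> = c powr r *\<^sub>R op_powr A r"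
    unfolding op_powr_def by (rule cfc_scale[OF A continuous_on_Icc_powr[OF a]])
  finally show ?thesis by (simp add: cfc_scale[OF A] cfc_id[OF A])
qed

lemma op_powr_inverse:
  assumes "A \<in> PD"
  shows "op_powr A r o\<^sub>L op_powr A (- r) = id_blinfun" "op_powr A (- r) o\<^sub>L op_powr A r = id_blinfun"
  using op_powr_add[OF assms, of r "-r"] op_powr_add[OF assms, of "-r" r] op_powr_0[OF assms] by simp_all

lemma op_powr_invertible: "A \<in> PD \<Longrightarrow> op_invertible (op_powr A r)"
  using op_powr_PD[of A r] by (simp add: PD_def)

lemma selfadjoint_log: "A \<in> PD \<Longrightarrow> selfadjoint (op_log A)"
  unfolding op_log_def
  by (erule PD_obtain_bounds, erule selfadjoint_cfc) (auto intro!: continuous_intros)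

lemma exp_PD: "selfadjoint H \<Longrightarrow> op_exp H \<in> PD"
  unfolding op_exp_def by (rule cfc_PD[OF op_between_norm]) (auto intro!: continuous_intros)

lemma op_powr_eq_exp_log:
  assumes "A \<in> PD" shows "op_powr A r = op_exp (r *\<^sub>R op_log A)"
proof -
  obtain a b where a: "0 < a" and A: "op_between a b A" using assms by (rule PD_obtain_bounds)
  have cl: "continuous_on {a..b} ln" using a by (intro continuous_on_subset[OF continuous_on_ln_pos]) auto
  have cr: "continuous_on {a..b} (\<lambda>x. r * ln x)" by (intro continuous_intros cl)
  have "op_exp (r *\<^sub>R op_log A) = cfc exp (cfc (\<lambda>x. r * ln x) A)"
    by (simp add: op_exp_def op_log_def cfc_scale[OF A cl])
  also have "\<dots> = cfc (\<lambda>x. exp (r * ln x)) A"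
  proof -
    obtain M where M: "\<And>x. x \<in> {a..b} \<Longrightarrow> r * ln x \<in> {-M..M}"
      using compact_imp_bounded[OF compact_continuous_image[OF cr compact_Icc]]
      by (force simp: bounded_iff abs_le_iff)
    show ?thesis by (rule cfc_compose[OF A cr M]) (auto intro!: continuous_intros)
  qed
  also have "\<dots> = op_powr A r"
    unfolding op_powr_def by (rule cfc_cong[OF A]) (use a in \<open>auto simp: powr_def intro!: continuous_intros cl\<close>)
  finally show ?thesis ..
qed

lemma op_log_exp:
  assumes H: "selfadjoint H" shows "op_log (op_exp H) = H"
proof -
  note B = op_between_norm[OF H]
  have "op_log (op_exp H) = cfc (\<lambda>x. ln (exp x)) H"
    unfolding op_log_def op_exp_def
    by (rule cfc_compose_pos[OF B _ _ continuous_on_ln_pos]) (auto intro!: continuous_intros)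
  then show ?thesis by (simp add: cfc_id[OF B])
qed

lemma op_exp_log: "A \<in> PD \<Longrightarrow> op_exp (op_log A) = A"
  using op_powr_eq_exp_log[of A 1] by (simp add: op_powr_1)

lemma op_log_powr: "A \<in> PD \<Longrightarrow> op_log (op_powr A r) = r *\<^sub>R op_log A"
  by (simp add: op_powr_eq_exp_log op_log_exp selfadjoint_scaleR selfadjoint_log)

text \<open>A convergent family is eventually bounded, so it stays in one order interval, on which \<open>cfc exp\<close> is norm
continuous.\<close>

lemma tendsto_op_exp:
  assumes X: "(X \<longlongrightarrow> H) F" and s: "\<forall>\<^sub>F p in F. selfadjoint (X p)" and H: "selfadjoint H"
  shows "((\<lambda>p. op_exp (X p)) \<longlongrightarrow> op_exp H) F"
proof -
  let ?R = "norm H + 1" let ?S = "{A :: 'b \<Rightarrow>\<^sub>L 'b. op_between (- ?R) ?R A}"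
  have c: "continuous_on ?S op_exp"
    unfolding op_exp_def[abs_def] by (rule continuous_on_cfc) (intro continuous_intros)
  have in_S: "A \<in> ?S" if "selfadjoint A" "norm A \<le> ?R" for A
    using op_between_mono[OF op_between_norm[OF that(1)]] that(2) by auto
  have "\<forall>\<^sub>F p in F. norm (X p) < ?R" by (rule order_tendstoD(2)[OF tendsto_norm[OF X]]) simp
  with s have "\<forall>\<^sub>F p in F. X p \<in> ?S" by eventually_elim (simp add: in_S[simplified])
  moreover have "H \<in> ?S" using H by (intro in_S) auto
  ultimately show ?thesis using c X by (auto intro: continuous_on_tendsto_compose)
qed

section \<open>Operator monotonicity of powers\<close>

text \<open>For self-adjoint factors \<open>Y X\<close> is the adjoint of \<open>X Y\<close>, so the two norms agree.\<close>

lemma norm_compose_flip_le: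
  assumes X: "selfadjoint X" and Y: "selfadjoint Y"
  shows "norm (Y o\<^sub>L X) \<le> norm (X o\<^sub>L Y)"
proof (rule norm_blinfun_bound)
  fix x
  let ?u = "blinfun_apply (Y o\<^sub>L X) x"
  have "norm ?u * norm ?u = inner ?u ?u"
    by (simp only: dot_square_norm power2_eq_square)
  also have "\<dots> = inner x (blinfun_apply (X o\<^sub>L Y) ?u)"
    using X Y by (simp add: selfadjoint_inner)
  also have "\<dots> \<le> norm x * (norm (X o\<^sub>L Y) * norm ?u)"
    by (rule order_trans[OF norm_cauchy_schwarz mult_left_mono[OF norm_blinfun]]) simp
  finally have "norm ?u * norm ?u \<le> (norm (X o\<^sub>L Y) * norm x) * norm ?u" by (simp add: mult_ac)
  moreover have "a \<le> b" if "a * a \<le> b * a" "0 \<le> a" "0 \<le> b" for a b :: real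
    using that by (metis mult_le_cancel_right_pos order_le_less)
  ultimately show "norm ?u \<le> norm (X o\<^sub>L Y) * norm x"
    by (meson mult_nonneg_nonneg norm_ge_zero)
qed simp

text \<open>Similar operators have the same spectrum, and for a self-adjoint operator the norm is read off from the
spectrum. So a self-adjoint operator similar to a contraction is a contraction, although similarity does
not preserve norms.\<close>

lemma norm_le_1_of_similar:
  fixes T N S S' :: "'a::chilbert_space \<Rightarrow>\<^sub>L 'a"
  assumes T: "selfadjoint T" and N: "norm N \<le> 1"
    and S: "S o\<^sub>L S' = id_blinfun" "S' o\<^sub>L S = id_blinfun" and TN: "T = S o\<^sub>L N o\<^sub>L S'"
  shows "norm T \<le> 1"
proof (rule ccontr)
  assume "\<not> ?thesis"
  then have n: "norm T > 1" by simp
  have inv: "op_invertible (T - c *\<^sub>R id_blinfun)" if c: "\<bar>c\<bar> > 1" for c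
  proof -
    have "norm ((1 / c) *\<^sub>R N) < 1" using c N by (simp add: field_simps)
    from neumann_series[OF this] have "op_invertible ((- c) *\<^sub>R (id_blinfun - (1 / c) *\<^sub>R N))"
      by (rule op_invertible_scaleR) (use c in auto)
    also have "(- c) *\<^sub>R (id_blinfun - (1 / c) *\<^sub>R N) = N - c *\<^sub>R id_blinfun"
      using c by (auto simp: algebra_simps)
    finally have "op_invertible (N - c *\<^sub>R id_blinfun)" .
    moreover have "op_invertible S" "op_invertible S'" using S by (auto simp: op_invertible_def)
    ultimately have "op_invertible (S o\<^sub>L (N - c *\<^sub>R id_blinfun) o\<^sub>L S')"
      by (intro op_invertible_compose)
    then show ?thesis by (simp add: TN blinfun_compose_simps S)
  qed
  have "norm T > 0" using n by linarith
  from norm_in_spectrum[OF T this] inv[of "norm T"] inv[of "- norm T"] n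
  show False by (auto simp: op_spectrum_def)
qed

lemma norm_powr_compose_le:
  assumes A: "A \<in> PD" and B: "B \<in> PD" and le: "loewner_le (op_powr A r) (op_powr B r)"
  shows "norm (op_powr A (r / 2) o\<^sub>L op_powr B (- (r / 2))) \<le> 1"
proof (rule norm_blinfun_bound)
  fix x
  let ?X = "op_powr A (r / 2)" and ?Y = "op_powr B (- (r / 2))"
  let ?y = "blinfun_apply ?Y x"
  have "inner (blinfun_apply (?X o\<^sub>L ?Y) x) (blinfun_apply (?X o\<^sub>L ?Y) x) = inner ?y (blinfun_apply (?X o\<^sub>L ?X) ?y)"
    by (simp add: selfadjoint_inner[OF op_powr_selfadjoint[OF A]])
  also have "\<dots> = inner ?y (blinfun_apply (op_powr A r) ?y)" by (simp add: op_powr_add[OF A])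
  also have "\<dots> \<le> inner ?y (blinfun_apply (op_powr B r) ?y)"
    using le loewner_le_iff[OF op_powr_selfadjoint[OF A] op_powr_selfadjoint[OF B]] by blast
  also have "\<dots> = inner x (blinfun_apply (?Y o\<^sub>L (op_powr B r o\<^sub>L ?Y)) x)"
    by (simp add: selfadjoint_inner[OF op_powr_selfadjoint[OF B]])
  also have "\<dots> = inner x x" by (simp only: op_powr_add[OF B]) (simp add: op_powr_0[OF B])
  finally show "norm (blinfun_apply (?X o\<^sub>L ?Y) x) \<le> 1 * norm x"
    by (simp add: norm_le)
qed simp

text \<open>Pedersen's argument. For \<open>q = (r + s) / 4\<close> the claim says that \<open>T = B\<^sup>-\<^sup>q A\<^sup>2\<^sup>q B\<^sup>-\<^sup>q\<close> is a contraction. Conjugation by a power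
of \<open>B\<close> moves \<open>T\<close> to \<open>N = (B\<^sup>-\<^sup>s\<^sup>/\<^sup>2 A\<^sup>s\<^sup>/\<^sup>2) (A\<^sup>r\<^sup>/\<^sup>2 B\<^sup>-\<^sup>r\<^sup>/\<^sup>2)\<close>, a product of two contractions by the two hypotheses.\<close>

lemma loewner_heinz_midpoint:
  assumes A: "A \<in> PD" and B: "B \<in> PD"
    and r: "loewner_le (op_powr A r) (op_powr B r)" and s: "loewner_le (op_powr A s) (op_powr B s)"
  shows "loewner_le (op_powr A ((r + s) / 2)) (op_powr B ((r + s) / 2))"
proof -
  define q where "q = (r + s) / 4"
  let ?T = "op_powr B (- q) o\<^sub>L op_powr A (2 * q) o\<^sub>L op_powr B (- q)"
  let ?N = "(op_powr B (- (s / 2)) o\<^sub>L op_powr A (s / 2)) o\<^sub>L (op_powr A (r / 2) o\<^sub>L op_powr B (- (r / 2)))"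
  let ?S = "op_powr B ((s - r) / 4)" and ?S' = "op_powr B (- ((s - r) / 4))"
  have saT: "selfadjoint ?T"
    by (intro selfadjoint_congruence op_powr_selfadjoint A B)
  have "norm ?N \<le> norm (op_powr B (- (s / 2)) o\<^sub>L op_powr A (s / 2)) * norm (op_powr A (r / 2) o\<^sub>L op_powr B (- (r / 2)))"
    by (rule norm_blinfun_compose)
  also have "\<dots> \<le> 1 * 1"
    using norm_powr_compose_le[OF A B r] norm_powr_compose_le[OF A B s]
      norm_compose_flip_le[OF op_powr_selfadjoint[OF A] op_powr_selfadjoint[OF B], of "- (s / 2)" "s / 2"]
    by (intro mult_mono) auto
  finally have N: "norm ?N \<le> 1" by simp
  have "?S o\<^sub>L ?N o\<^sub>L ?S' = (?S o\<^sub>L op_powr B (- (s / 2))) o\<^sub>L (op_powr A (s / 2) o\<^sub>L op_powr A (r / 2)) o\<^sub>L (op_powr B (- (r / 2)) o\<^sub>L ?S')"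
    by (simp add: blinfun_compose_assoc)
  also have "\<dots> = op_powr B ((s - r) / 4 + - (s / 2)) o\<^sub>L op_powr A (s / 2 + r / 2) o\<^sub>L op_powr B (- (r / 2) + - ((s - r) / 4))"
    by (simp only: op_powr_add[OF A] op_powr_add[OF B])
  also have "(s - r) / 4 + - (s / 2) = - q"
    by (simp add: q_def field_simps)
  also have "s / 2 + r / 2 = 2 * q"
    by (simp add: q_def field_simps)
  also have "- (r / 2) + - ((s - r) / 4) = - q"
    by (simp add: q_def field_simps)
  finally have TN: "?T = ?S o\<^sub>L ?N o\<^sub>L ?S'" ..
  have "norm ?T \<le> 1"
    by (rule norm_le_1_of_similar[OF saT N op_powr_inverse[OF B] TN])
  then have "loewner_le ?T id_blinfun"
    using op_between_mono[OF op_between_norm[OF saT], of "-1" 1] by (simp add: op_between_loewner)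
  then have "loewner_le (op_powr B q o\<^sub>L ?T o\<^sub>L op_powr B q) (op_powr B q o\<^sub>L id_blinfun o\<^sub>L op_powr B q)"
    by (rule loewner_le_congruence) (rule op_powr_selfadjoint[OF B])
  also have "op_powr B q o\<^sub>L ?T o\<^sub>L op_powr B q = (op_powr B q o\<^sub>L op_powr B (- q)) o\<^sub>L op_powr A (2 * q) o\<^sub>L (op_powr B (- q) o\<^sub>L op_powr B q)"
    by (simp add: blinfun_compose_assoc)
  also have "\<dots> = op_powr A (2 * q)" by (simp add: op_powr_inverse[OF B])
  also have "op_powr B q o\<^sub>L id_blinfun o\<^sub>L op_powr B q = op_powr B (2 * q)" by (simp add: op_powr_add[OF B])
  also have "2 * q = (r + s) / 2" by (simp add: q_def)
  finally show ?thesis .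
qed

lemma closed_midpoint_convex_01:
  fixes E :: "real set"
  assumes "closed E" "E \<subseteq> {0..1}" "0 \<in> E" "1 \<in> E" and mid: "\<And>r s. r \<in> E \<Longrightarrow> s \<in> E \<Longrightarrow> (r + s) / 2 \<in> E"
  shows "{0..1} \<subseteq> E"
proof
  fix r :: real assume r: "r \<in> {0..1}"
  show "r \<in> E"
  proof (rule ccontr)
    assume no: "r \<notin> E"
    have "compact (E \<inter> {0..r})" "compact (E \<inter> {r..1})" using assms(1) by (auto intro: closed_Int_compact)
    moreover have "E \<inter> {0..r} \<noteq> {}" "E \<inter> {r..1} \<noteq> {}" using assms(3,4) r by auto
    ultimately obtain u v where u: "u \<in> E \<inter> {0..r}" "\<And>x. x \<in> E \<inter> {0..r} \<Longrightarrow> x \<le> u"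
      and v: "v \<in> E \<inter> {r..1}" "\<And>x. x \<in> E \<inter> {r..1} \<Longrightarrow> v \<le> x"
      by (metis compact_attains_sup compact_attains_inf)
    have "u < r" "r < v" using u v no by (auto simp: less_le)
    moreover have "(u + v) / 2 \<in> E" using mid u v by auto
    ultimately show False
      using u(2)[of "(u + v) / 2"] v(2)[of "(u + v) / 2"] u(1) v(1) by (cases "(u + v) / 2 \<le> r") auto
  qed
qed

text \<open>The exponents \<open>r\<close> with \<open>A\<^sup>r \<le> B\<^sup>r\<close> form a closed set that contains \<open>0\<close> and \<open>1\<close> and is closed under midpoints.\<close>

theorem loewner_heinz:
  assumes A: "A \<in> PD" and B: "B \<in> PD" and le: "loewner_le A B" and r: "0 \<le> r" "r \<le> 1"
  shows "loewner_le (op_powr A r) (op_powr B r)"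
proof -
  let ?E = "{r \<in> {0..1}. op_powr B r - op_powr A r \<in> {A. pos_semidef A}}"
  have c: "continuous_on {0..1} (\<lambda>r. op_powr X r)" if "X \<in> PD" for X :: "'a \<Rightarrow>\<^sub>L 'a"
    unfolding op_powr_eq_exp_log[OF that] continuous_on_def
    using that by (intro ballI tendsto_op_exp tendsto_intros) (auto intro!: always_eventually selfadjoint_scaleR selfadjoint_log)
  have cont: "continuous_on {0..1} (\<lambda>r. op_powr B r - op_powr A r)"
    by (intro continuous_intros c A B)
  have "closed ({0..1} \<inter> (\<lambda>r. op_powr B r - op_powr A r) -` {A. pos_semidef A})"
    by (rule continuous_closed_preimage[OF cont closed_atLeastAtMost closed_pos_semidef])
  also have "{0..1} \<inter> (\<lambda>r. op_powr B r - op_powr A r) -` {A. pos_semidef A} = ?E" by auto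
  finally have "{0..1} \<subseteq> ?E"
  proof (rule closed_midpoint_convex_01)
    show "0 \<in> ?E" "1 \<in> ?E" using le A B by (simp_all add: op_powr_0 op_powr_1 loewner_le_def)
    show "(r + s) / 2 \<in> ?E" if "r \<in> ?E" "s \<in> ?E" for r s
      using loewner_heinz_midpoint[OF A B, of r s] that by (simp add: loewner_le_def)
  qed auto
  then show ?thesis using r by (auto simp: loewner_le_def)
qed

section \<open>Fixed points of homogeneous order-preserving maps\<close>

lemma pos_semidef_id [simp]: "pos_semidef id_blinfun"
  by (simp add: pos_semidef_iff)

lemma id_PD: "id_blinfun \<in> PD"
  by (rule op_between_PD[of 1 1]) (simp_all add: op_between_loewner)

lemma loewner_le_norm_id: "selfadjoint X \<Longrightarrow> loewner_le X (norm X *\<^sub>R id_blinfun)"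
  using op_between_norm[of X] by (simp add: op_between_loewner)

lemma PD_le_exp:
  assumes X: "selfadjoint X" and Y: "Y \<in> PD"
  obtains m where "loewner_le X (exp m *\<^sub>R Y)"
proof -
  obtain a b where a: "0 < a" and Yb: "op_between a b Y" using Y by (rule PD_obtain_bounds)
  let ?k = "(norm X + 1) / a"
  have k: "?k > 0" using a by (intro divide_pos_pos add_nonneg_pos) auto
  have "loewner_le X (norm X *\<^sub>R id_blinfun)" by (rule loewner_le_norm_id[OF X])
  also have "loewner_le (norm X *\<^sub>R id_blinfun) ((norm X + 1) *\<^sub>R id_blinfun)"
    by (rule loewner_le_scaleR_left) auto
  also have "(norm X + 1) *\<^sub>R id_blinfun = ?k *\<^sub>R (a *\<^sub>R id_blinfun)" using a by simp
  also have "loewner_le (?k *\<^sub>R (a *\<^sub>R id_blinfun)) (?k *\<^sub>R Y)"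
    using Yb k by (intro loewner_le_scaleR) (auto simp: op_between_loewner)
  also have "?k = exp (ln ?k)" using k by simp
  finally show thesis by (rule that)
qed

text \<open>Passes from multiplicative to norm closeness, for operators below a common multiple of the identity.\<close>

lemma norm_diff_le_of_ratio:
  assumes "loewner_le X (exp u *\<^sub>R Y)" "loewner_le Y (exp u *\<^sub>R X)" "0 \<le> u" "0 \<le> c"
    and X: "X \<in> PD" "loewner_le X (c *\<^sub>R id_blinfun)" and Y: "Y \<in> PD" "loewner_le Y (c *\<^sub>R id_blinfun)"
  shows "norm (X - Y) \<le> (exp u - 1) * c"
proof -
  have le: "loewner_le (X - Y) (((exp u - 1) * c) *\<^sub>R id_blinfun)"
    if XY: "loewner_le X (exp u *\<^sub>R Y)" and Y: "loewner_le Y (c *\<^sub>R id_blinfun)" for X Y :: "'a \<Rightarrow>\<^sub>L 'a"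
  proof -
    have "loewner_le (X - Y) ((exp u - 1) *\<^sub>R Y)"
      using loewner_le_add[OF XY, of "- Y" "- Y"] by (simp add: algebra_simps)
    also have "loewner_le ((exp u - 1) *\<^sub>R Y) ((exp u - 1) *\<^sub>R (c *\<^sub>R id_blinfun))"
      by (rule loewner_le_scaleR[OF _ Y]) (use \<open>0 \<le> u\<close> in simp)
    finally show ?thesis by simp
  qed
  let ?s = "(exp u - 1) * c"
  have "loewner_le (Y - X) (?s *\<^sub>R id_blinfun)" "loewner_le (X - Y) (?s *\<^sub>R id_blinfun)"
    using le assms by blast+
  then have "op_between (- ?s) ?s (X - Y)"
    by (simp add: op_between_loewner loewner_le_def algebra_simps)
  then show ?thesis by (rule norm_le_of_op_between) (use \<open>0 \<le> u\<close> \<open>0 \<le> c\<close> in simp)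
qed

text \<open>Passes from norm to multiplicative closeness, when \<open>X\<close> is bounded below by \<open>I / c\<close>: then
\<open>Y \<le> X + d I \<le> (1 + c d) X\<close> for \<open>d = \<parallel>Y - X\<parallel>\<close>.\<close>

lemma loewner_le_exp_of_norm:
  assumes X: "X \<in> PD" "loewner_le id_blinfun (c *\<^sub>R X)" and Y: "selfadjoint Y" and "0 \<le> c"
  shows "loewner_le Y (exp (c * norm (Y - X)) *\<^sub>R X)"
proof -
  let ?d = "norm (Y - X)"
  have "loewner_le (Y - X) (?d *\<^sub>R id_blinfun)"
    by (intro loewner_le_norm_id selfadjoint_diff Y PD_selfadjoint[OF X(1)])
  also have "loewner_le (?d *\<^sub>R id_blinfun) (?d *\<^sub>R (c *\<^sub>R X))"
    by (intro loewner_le_scaleR X) simp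
  finally have "loewner_le (X + (Y - X)) (X + ?d *\<^sub>R (c *\<^sub>R X))"
    by (intro loewner_le_add) auto
  also have "X + ?d *\<^sub>R (c *\<^sub>R X) = (1 + c * ?d) *\<^sub>R X" by (simp add: algebra_simps)
  also have "loewner_le \<dots> (exp (c * ?d) *\<^sub>R X)"
    by (intro loewner_le_scaleR_left PD_pos_semidef[OF X(1)] exp_ge_add_one_self_aux) (use \<open>0 \<le> c\<close> in auto)
  finally show ?thesis by simp
qed

lemma exp_minus_one_le: "exp u - 1 \<le> u * exp u" for u :: real
proof -
  have "(1 + - u) * exp u \<le> exp (- u) * exp u"
    by (intro mult_right_mono exp_ge_add_one_self) simp
  then show ?thesis by (simp add: exp_minus algebra_simps)
qed

text \<open>Order preserving maps of the cone that are homogeneous of degree \<open>t < 1\<close> are strict contractions for the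
Thompson metric. The proofs below do not use the metric itself but its description by factors:
\<open>X \<le> e\<^sup>m Y\<close> implies \<open>F X \<le> e\<^sup>t\<^sup>m F Y\<close>.\<close>

locale homogeneous_order_map =
  fixes F :: "('a::chilbert_space \<Rightarrow>\<^sub>L 'a) \<Rightarrow> ('a \<Rightarrow>\<^sub>L 'a)" and t :: real
  assumes t: "0 \<le> t" "t < 1"
    and PD: "X \<in> PD \<Longrightarrow> F X \<in> PD"
    and mono: "X \<in> PD \<Longrightarrow> Y \<in> PD \<Longrightarrow> loewner_le X Y \<Longrightarrow> loewner_le (F X) (F Y)"
    and hom: "X \<in> PD \<Longrightarrow> 0 < c \<Longrightarrow> F (c *\<^sub>R X) = c powr t *\<^sub>R F X"
begin

lemma map_le_exp:
  assumes "X \<in> PD" "Y \<in> PD" "loewner_le X (exp m *\<^sub>R Y)"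
  shows "loewner_le (F X) (exp (t * m) *\<^sub>R F Y)"
  using mono[OF assms(1) PD_scaleR[OF assms(2)] assms(3)] hom[OF assms(2), of "exp m"]
  by (simp add: powr_def)

text \<open>From \<open>X \<le> e\<^sup>r Y\<close> follows \<open>X \<le> e\<^sup>l F X \<le> e\<^bsup>l + tr\<^esup> F Y \<le> e\<^bsup>l + l' + tr\<^esup> Y\<close>. The exponents produced by iterating
\<open>r \<mapsto> l + l' + t r\<close> converge to its fixed point \<open>(l + l') / (1 - t)\<close>. With \<open>l = l' = 0\<close> this is uniqueness of the
fixed point; with small \<open>l'\<close> it locates the fixed point near an approximate one.\<close>

lemma subsolution_le_supersolution:
  assumes X: "X \<in> PD" "loewner_le X (exp l *\<^sub>R F X)" and Y: "Y \<in> PD" "loewner_le (F Y) (exp l' *\<^sub>R Y)"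
  shows "loewner_le X (exp ((l + l') / (1 - t)) *\<^sub>R Y)"
proof -
  let ?L = "(l + l') / (1 - t)"
  have L: "l + l' + t * ?L = ?L" using t by (simp add: field_simps)
  obtain m where m: "loewner_le X (exp m *\<^sub>R Y)" using PD_le_exp[OF PD_selfadjoint[OF X(1)] Y(1)] .
  have step: "loewner_le X (exp (l + l' + t * r) *\<^sub>R Y)" if r: "loewner_le X (exp r *\<^sub>R Y)" for r
  proof -
    have "loewner_le (exp l *\<^sub>R F X) (exp l *\<^sub>R (exp (t * r) *\<^sub>R F Y))"
      by (intro loewner_le_scaleR map_le_exp X Y r) simp
    also have "loewner_le (exp l *\<^sub>R (exp (t * r) *\<^sub>R F Y)) (exp l *\<^sub>R (exp (t * r) *\<^sub>R (exp l' *\<^sub>R Y)))"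
      by (intro loewner_le_scaleR Y) simp_all
    finally show ?thesis using loewner_le_trans[OF X(2)] by (simp add: exp_add mult_ac)
  qed
  have "loewner_le X (exp (?L + t ^ k * (m - ?L)) *\<^sub>R Y)" for k
  proof (induction k)
    case (Suc k)
    have "l + l' + t * (?L + t ^ k * (m - ?L)) = ?L + t ^ Suc k * (m - ?L)"
      using L by (simp add: algebra_simps)
    with step[OF Suc] show ?case by simp
  qed (use m in simp)
  moreover have "(\<lambda>k. exp (?L + t ^ k * (m - ?L)) *\<^sub>R Y) \<longlonglongrightarrow> exp (?L + 0 * (m - ?L)) *\<^sub>R Y"
    by (intro tendsto_intros LIMSEQ_realpow_zero t)
  ultimately show ?thesis
    using loewner_le_tendsto[OF tendsto_const[of X], of "\<lambda>k. exp (?L + t ^ k * (m - ?L)) *\<^sub>R Y" _ sequentially] by simp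
qed

lemma fixed_point_unique:
  assumes "X \<in> PD" "F X = X" "Y \<in> PD" "F Y = Y" shows "X = Y"
  using subsolution_le_supersolution[of X 0 Y 0] subsolution_le_supersolution[of Y 0 X 0] assms
  by (intro loewner_le_antisym) auto

text \<open>The iterates \<open>X\<^sub>k\<close> of the identity satisfy \<open>e\<^bsup>-u\<^esup> X\<^sub>k \<le> X\<^bsub>k+1\<^esub> \<le> e\<^bsup>u\<^esup> X\<^sub>k\<close> with \<open>u = t\<^sup>k l\<close> and stay between \<open>e\<^bsup>-L\<^esup> I\<close> and
\<open>e\<^sup>L I\<close>, where \<open>L = l + t L\<close>. Hence they form a Cauchy sequence in norm. The limit is a fixed point because norm
convergence inside the cone gives convergence up to factors, which \<open>F\<close> respects.\<close>

lemma fixed_point_exists: "\<exists>X\<in>PD. F X = X"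
proof -
  define X where "X k = (F ^^ k) id_blinfun" for k
  have X0: "X 0 = id_blinfun" and XS: "X (Suc k) = F (X k)" for k by (simp_all add: X_def)
  have XP: "X k \<in> PD" for k by (induction k) (simp_all add: X0 XS id_PD PD)
  obtain l1 where l1: "loewner_le id_blinfun (exp l1 *\<^sub>R F id_blinfun)"
    using PD_le_exp[OF selfadjoint_id PD[OF id_PD]] .
  obtain l2 where l2: "loewner_le (F id_blinfun) (exp l2 *\<^sub>R id_blinfun)"
    using PD_le_exp[OF PD_selfadjoint[OF PD[OF id_PD]] id_PD] .
  define l where "l = max 0 (max l1 l2)"
  have l: "0 \<le> l" "loewner_le (X 0) (exp l *\<^sub>R X (Suc 0))" "loewner_le (X (Suc 0)) (exp l *\<^sub>R X 0)"
    unfolding X0 XS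
    by (auto simp: l_def intro!: loewner_le_trans[OF l1] loewner_le_trans[OF l2] loewner_le_scaleR_left PD_pos_semidef id_PD PD)
  define L where "L = l / (1 - t)"
  have L: "0 \<le> L" "l + t * L = L" using l t by (simp_all add: L_def field_simps)
  have step: "loewner_le (X k) (exp (t ^ k * l) *\<^sub>R X (Suc k)) \<and> loewner_le (X (Suc k)) (exp (t ^ k * l) *\<^sub>R X k)" for k
  proof (induction k)
    case (Suc k)
    then show ?case
      using map_le_exp[OF XP XP, of k "t ^ k * l" "Suc k"] map_le_exp[OF XP XP, of "Suc k" "t ^ k * l" k]
      by (simp add: XS[symmetric] mult.assoc)
  qed (use l in simp)
  have bd: "loewner_le (X k) (exp L *\<^sub>R id_blinfun) \<and> loewner_le id_blinfun (exp L *\<^sub>R X k)" for k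
  proof (induction k)
    case 0 show ?case using L loewner_le_scaleR_left[of 1 "exp L" id_blinfun] by (simp add: X0)
  next
    case (Suc k)
    have "loewner_le (X (Suc k)) (exp (t * L) *\<^sub>R F id_blinfun)"
      unfolding XS by (intro map_le_exp XP id_PD) (use Suc in blast)
    also have "loewner_le (exp (t * L) *\<^sub>R F id_blinfun) (exp (t * L) *\<^sub>R (exp l *\<^sub>R id_blinfun))"
      using l(3) by (intro loewner_le_scaleR) (simp_all add: X0 XS)
    also have "exp (t * L) *\<^sub>R (exp l *\<^sub>R id_blinfun) = exp L *\<^sub>R id_blinfun"
      by (subst (2) L(2)[symmetric]) (simp add: exp_add mult.commute)
    finally have 1: "loewner_le (X (Suc k)) (exp L *\<^sub>R id_blinfun)" .
    have "loewner_le id_blinfun (exp l *\<^sub>R F id_blinfun)" using l(2) by (simp add: X0 XS)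
    also have "loewner_le (exp l *\<^sub>R F id_blinfun) (exp l *\<^sub>R (exp (t * L) *\<^sub>R F (X k)))"
      by (intro loewner_le_scaleR map_le_exp XP id_PD) (use Suc in auto)
    also have "exp l *\<^sub>R (exp (t * L) *\<^sub>R F (X k)) = exp L *\<^sub>R X (Suc k)"
      by (subst (2) L(2)[symmetric]) (simp add: exp_add XS)
    finally show ?case using 1 by blast
  qed
  have dk: "norm (X (Suc k) - X k) \<le> l * exp l * exp L * t ^ k" for k
  proof -
    let ?u = "t ^ k * l"
    have u: "0 \<le> ?u" "?u \<le> l" using l t by (simp_all add: mult_left_le_one_le power_le_one)
    have "norm (X (Suc k) - X k) \<le> (exp ?u - 1) * exp L"
      using step[of k] bd u by (intro norm_diff_le_of_ratio XP) auto
    also have "\<dots> \<le> (?u * exp ?u) * exp L"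
      by (intro mult_right_mono exp_minus_one_le) simp
    also have "\<dots> \<le> (?u * exp l) * exp L" using u by (intro mult_right_mono mult_left_mono) auto
    finally show ?thesis by (simp add: mult_ac)
  qed
  have "summable (\<lambda>k. X (Suc k) - X k)"
    by (rule summable_comparison_test'[OF summable_mult[OF summable_geometric] dk]) (use t in simp)
  then have "(\<lambda>k. \<Sum>i<k. X (Suc i) - X i) \<longlonglongrightarrow> suminf (\<lambda>k. X (Suc k) - X k)"
    by (rule summable_LIMSEQ)
  then have "(\<lambda>k. X 0 + (X k - X 0)) \<longlonglongrightarrow> X 0 + suminf (\<lambda>k. X (Suc k) - X k)"
    unfolding sum_lessThan_telescope by (rule tendsto_add[OF tendsto_const])
  then obtain Z where Z: "X \<longlonglongrightarrow> Z" by auto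
  have IZ: "loewner_le id_blinfun (exp L *\<^sub>R Z)"
    by (rule loewner_le_tendsto[OF tendsto_const tendsto_scaleR[OF tendsto_const Z]]) (use bd in auto)
  have "exp (- L) *\<^sub>R (exp L *\<^sub>R Z) \<in> PD"
    by (rule PD_scaleR[OF PD_mono[OF id_PD IZ]]) simp
  then have ZP: "Z \<in> PD" by (simp add: exp_minus)
  let ?e = "\<lambda>k. exp (t * (exp L * norm (X k - Z)))"
  have e: "?e \<longlonglongrightarrow> exp (t * (exp L * norm (Z - Z)))" by (intro tendsto_intros Z)
  have Z': "(\<lambda>k. F (X k)) \<longlonglongrightarrow> Z" using LIMSEQ_Suc[OF Z] by (simp add: XS)
  have "loewner_le (F (X k)) (?e k *\<^sub>R F Z)" for k
    by (intro map_le_exp loewner_le_exp_of_norm IZ ZP XP PD_selfadjoint) simp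
  then have "loewner_le Z (1 *\<^sub>R F Z)"
    using loewner_le_tendsto[OF Z' tendsto_scaleR[OF e tendsto_const]] by simp
  moreover have "loewner_le (F Z) (?e k *\<^sub>R F (X k))" for k
    unfolding norm_minus_commute[of "X k"]
    by (intro map_le_exp loewner_le_exp_of_norm ZP XP PD_selfadjoint) (use bd in auto)
  then have "loewner_le (F Z) (1 *\<^sub>R Z)"
    using loewner_le_tendsto[OF tendsto_const tendsto_scaleR[OF e Z']] by simp
  ultimately show ?thesis using ZP loewner_le_antisym by auto
qed

end

section \<open>The map defining the Renyi power mean\<close>

lemma PD_sum:
  assumes "finite I" "I \<noteq> {}" "\<And>j. j \<in> I \<Longrightarrow> X j \<in> PD" shows "sum X I \<in> PD"
  using assms
  by (induction I rule: finite_ne_induct) (auto intro: PD_add PD_pos_semidef)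

definition renyi_map ::
    "real \<Rightarrow> real \<Rightarrow> nat \<Rightarrow> (nat \<Rightarrow> real) \<Rightarrow> (nat \<Rightarrow> ('a::chilbert_space \<Rightarrow>\<^sub>L 'a)) \<Rightarrow> ('a \<Rightarrow>\<^sub>L 'a) \<Rightarrow> ('a \<Rightarrow>\<^sub>L 'a)"
  where "renyi_map t z n w A X = (\<Sum>j=1..n. w j *\<^sub>R
      op_powr (op_powr (A j) ((1 - t) / (2 * z)) o\<^sub>L op_powr X (t / z)
        o\<^sub>L op_powr (A j) ((1 - t) / (2 * z))) z)"

text \<open>Both exponents \<open>t / z\<close> and \<open>z\<close> lie in \<open>[0, 1]\<close>, so the two power maps are order preserving by the
Loewner-Heinz inequality; their degrees multiply to \<open>(t / z) z = t\<close>.\<close>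

lemma homogeneous_order_map_renyi_map:
  assumes A: "\<And>j. j \<in> {1..n} \<Longrightarrow> A j \<in> PD" and w: "w \<in> prob_vectors n"
    and t: "0 \<le> t" "t < z" "z \<le> 1"
  shows "homogeneous_order_map (renyi_map t z n w A) t"
proof
  show "0 \<le> t" "t < 1" using t by auto
  have z: "0 < z" using t by auto
  let ?C = "\<lambda>j. op_powr (A j) ((1 - t) / (2 * z))"
  let ?T = "\<lambda>X j. ?C j o\<^sub>L op_powr X (t / z) o\<^sub>L ?C j"
  have C: "selfadjoint (?C j)" "op_invertible (?C j)" if "j \<in> {1..n}" for j
    using A[OF that] by (auto intro: op_powr_selfadjoint op_powr_invertible)
  have T: "?T X j \<in> PD" if "X \<in> PD" "j \<in> {1..n}" for X j
    using C[OF that(2)] that(1) by (intro PD_congruence op_powr_PD)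
  have w0: "0 < w j" if "j \<in> {1..n}" for j using w that by (simp add: prob_vectors_def)
  have ne: "{1..n} \<noteq> {}" using w by (cases n) (auto simp: prob_vectors_def)
  show "renyi_map t z n w A X \<in> PD" if "X \<in> PD" for X
    unfolding renyi_map_def using ne that by (intro PD_sum PD_scaleR op_powr_PD T w0) auto
  show "loewner_le (renyi_map t z n w A X) (renyi_map t z n w A Y)"
    if X: "X \<in> PD" and Y: "Y \<in> PD" and le: "loewner_le X Y" for X Y
    unfolding renyi_map_def
  proof (rule loewner_le_sum)
    fix j assume j: "j \<in> {1..n}"
    have "loewner_le (op_powr X (t / z)) (op_powr Y (t / z))"
      using t z by (intro loewner_heinz X Y le) auto
    then have "loewner_le (?T X j) (?T Y j)" by (rule loewner_le_congruence[OF _ C(1)[OF j]])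
    then have "loewner_le (op_powr (?T X j) z) (op_powr (?T Y j) z)"
      using t z by (intro loewner_heinz T X Y j) auto
    then show "loewner_le (w j *\<^sub>R op_powr (?T X j) z) (w j *\<^sub>R op_powr (?T Y j) z)"
      using w0[OF j] by (intro loewner_le_scaleR) auto
  qed
  show "renyi_map t z n w A (c *\<^sub>R X) = c powr t *\<^sub>R renyi_map t z n w A X" if X: "X \<in> PD" and c: "0 < c" for X c
    unfolding renyi_map_def scaleR_sum_right
  proof (rule sum.cong[OF refl])
    fix j assume j: "j \<in> {1..n}"
    have "?T (c *\<^sub>R X) j = c powr (t / z) *\<^sub>R ?T X j"
      by (simp add: op_powr_scaleR[OF X c] blinfun_compose_simps)
    then have "op_powr (?T (c *\<^sub>R X) j) z = c powr t *\<^sub>R op_powr (?T X j) z"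
      using c z by (simp add: op_powr_scaleR[OF T[OF X j]] powr_powr)
    then show "w j *\<^sub>R op_powr (?T (c *\<^sub>R X) j) z = c powr t *\<^sub>R w j *\<^sub>R op_powr (?T X j) z"
      by (simp add: mult.commute)
  qed
qed

lemma renyi_mean_fixed_point:
  assumes "\<And>j. j \<in> {1..n} \<Longrightarrow> A j \<in> PD" and "w \<in> prob_vectors n"
    and "0 \<le> t" "t < z" "z \<le> 1"
  shows "renyi_mean t z n w A \<in> PD"
    and "renyi_map t z n w A (renyi_mean t z n w A) = renyi_mean t z n w A"
proof -
  interpret homogeneous_order_map "renyi_map t z n w A" t
    using assms by (rule homogeneous_order_map_renyi_map)
  obtain X where X: "X \<in> PD" "renyi_map t z n w A X = X" using fixed_point_exists by blast
  have "renyi_mean t z n w A = (THE X. X \<in> PD \<and> X = renyi_map t z n w A X)"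
    unfolding renyi_mean_def renyi_map_def ..
  also have "\<dots> = X"
    by (rule the_equality) (use X fixed_point_unique in auto)
  finally show "renyi_mean t z n w A \<in> PD" "renyi_map t z n w A (renyi_mean t z n w A) = renyi_mean t z n w A"
    using X by auto
qed

section \<open>First-order expansion of the Renyi power mean\<close>

lemma has_vector_derivative_at_0_iff:
  fixes f :: "real \<Rightarrow> 'b::real_normed_vector"
  shows "(f has_vector_derivative K) (at 0) \<longleftrightarrow> ((\<lambda>p. (1 / p) *\<^sub>R (f p - f 0)) \<longlongrightarrow> K) (at 0)"
proof -
  have "\<forall>\<^sub>F p in at 0. norm (f p - f 0 - (p - 0) *\<^sub>R K) / norm (p - 0) = norm ((1 / p) *\<^sub>R (f p - f 0) - K)"
    unfolding eventually_at_filter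
  proof (intro always_eventually allI impI)
    fix p :: real assume p: "p \<noteq> 0"
    have "norm ((1 / p) *\<^sub>R (f p - f 0) - K) = norm ((1 / p) *\<^sub>R (f p - f 0 - p *\<^sub>R K))"
      using p by (simp add: scaleR_diff_right)
    then show "norm (f p - f 0 - (p - 0) *\<^sub>R K) / norm (p - 0) = norm ((1 / p) *\<^sub>R (f p - f 0) - K)"
      by (simp only: norm_scaleR) simp
  qed
  from tendsto_cong[OF this, of 0]
  have "(f has_vector_derivative K) (at 0) \<longleftrightarrow> ((\<lambda>p. norm ((1 / p) *\<^sub>R (f p - f 0) - K)) \<longlongrightarrow> 0) (at 0)"
    unfolding has_vector_derivative_def has_derivative_iff_norm
    by (simp add: bounded_linear_scaleR_left)
  also have "\<dots> \<longleftrightarrow> ((\<lambda>p. (1 / p) *\<^sub>R (f p - f 0)) \<longlongrightarrow> K) (at 0)"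
    by (subst Lim_null[of _ K]) (rule tendsto_norm_zero_iff)
  finally show ?thesis .
qed

lemma has_vector_derivative_0_dominated:
  assumes f: "(f has_vector_derivative 0) (at 0)" and f0: "f 0 = 0"
    and le: "\<forall>\<^sub>F p in nhds 0. norm (g p) \<le> C * norm (f p)"
  shows "(g has_vector_derivative 0) (at (0::real))"
proof -
  have g0: "g 0 = 0" using eventually_nhds_x_imp_x[OF le] f0 by simp
  have lim: "((\<lambda>p. C * norm ((1 / p) *\<^sub>R (f p - f 0))) \<longlongrightarrow> 0) (at 0)"
    using tendsto_mult_right_zero[OF tendsto_norm_zero[OF f[unfolded has_vector_derivative_at_0_iff]]] .
  have "\<forall>\<^sub>F p in at 0. norm ((1 / p) *\<^sub>R (g p - g 0)) \<le> C * norm ((1 / p) *\<^sub>R (f p - f 0))"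
    using le unfolding eventually_at_filter
  proof eventually_elim
    case (elim p)
    then show ?case using mult_left_mono[OF elim, of "1 / \<bar>p\<bar>"] by (simp add: f0 g0 mult_ac)
  qed
  then have "((\<lambda>p. (1 / p) *\<^sub>R (g p - g 0)) \<longlongrightarrow> 0) (at 0)"
    by (rule Lim_null_comparison[OF _ lim])
  then show ?thesis unfolding has_vector_derivative_at_0_iff .
qed

lemma cfc_curve_has_vector_derivative:
  fixes X :: "real \<Rightarrow> ('a::chilbert_space \<Rightarrow>\<^sub>L 'a)"
  assumes X: "(X has_vector_derivative K) (at 0)" and X0: "X 0 = c *\<^sub>R id_blinfun"
    and s: "\<And>p. selfadjoint (X p)"
    and r: "r > 0" and f: "continuous_on {c - r..c + r} f" and D: "(f has_real_derivative d) (at c)"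
  shows "((\<lambda>p. cfc f (X p)) has_vector_derivative d *\<^sub>R K) (at 0)"
proof -
  have "(cfc f has_derivative (\<lambda>K. d *\<^sub>R K)) (at (X 0) within range X)"
    unfolding X0 by (rule has_derivative_subset[OF cfc_has_derivative_scalar[OF r f D]]) (use s in auto)
  from has_derivative_in_compose[OF X[unfolded has_vector_derivative_def] this]
  show ?thesis by (simp add: has_vector_derivative_def mult.commute)
qed

lemma exp_curve_has_vector_derivative:
  assumes "selfadjoint K"
  shows "((\<lambda>p. op_exp (p *\<^sub>R K)) has_vector_derivative K) (at 0)"
proof -
  have "((\<lambda>p. p *\<^sub>R K) has_vector_derivative K) (at 0)"
    by (auto intro!: derivative_eq_intros)
  then have "((\<lambda>p. cfc exp (p *\<^sub>R K)) has_vector_derivative 1 *\<^sub>R K) (at 0)"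
    by (rule cfc_curve_has_vector_derivative[where r = 1 and c = 0])
       (auto intro!: selfadjoint_scaleR assms continuous_intros derivative_eq_intros)
  then show ?thesis by (simp add: op_exp_def)
qed

lemma powr_curve_has_vector_derivative:
  assumes "(X has_vector_derivative K) (at 0)" "X 0 = id_blinfun" "\<And>p. X p \<in> PD"
  shows "((\<lambda>p. op_powr (X p) r) has_vector_derivative r *\<^sub>R K) (at 0)"
proof -
  have "((\<lambda>x. x powr r) has_real_derivative r) (at 1)"
    by (auto intro!: derivative_eq_intros)
  then show ?thesis
    unfolding op_powr_def
    by (rule cfc_curve_has_vector_derivative[where r = "1/2" and c = 1, rotated -1])
       (use assms in \<open>auto intro!: PD_selfadjoint continuous_on_Icc_powr\<close>)
qed

lemma log_curve_has_vector_derivative: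
  assumes "(X has_vector_derivative K) (at 0)" "X 0 = id_blinfun" "\<And>p. X p \<in> PD"
  shows "((\<lambda>p. op_log (X p)) has_vector_derivative K) (at 0)"
proof -
  have "(ln has_real_derivative 1) (at 1)"
    by (auto intro!: derivative_eq_intros)
  then have "((\<lambda>p. cfc ln (X p)) has_vector_derivative 1 *\<^sub>R K) (at 0)"
    by (rule cfc_curve_has_vector_derivative[where r = "1/2" and c = 1, rotated -1])
       (use assms in \<open>auto intro!: PD_selfadjoint continuous_intros\<close>)
  then show ?thesis by (simp add: op_log_def)
qed

lemma op_exp_0: "op_exp 0 = id_blinfun"
  using cfc_scalar[of 0 exp] by (simp add: op_exp_def)

lemma op_log_id: "op_log id_blinfun = 0"
  using op_log_exp[of 0] by (simp add: op_exp_0)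

lemma op_powr_id: "op_powr id_blinfun r = id_blinfun"
  using op_powr_eq_exp_log[OF id_PD, of r] by (simp add: op_log_id op_exp_0)

text \<open>To first order in \<open>p\<close> all factors are near the identity and noncommutativity disappears: the \<open>j\<close>-th summand
has derivative \<open>z ((1 - t) / z log A\<^sub>j + t / z H)\<close>, and the weighted sum is \<open>(1 - t) H + t H = H\<close>. So
\<open>exp (p H)\<close> solves the fixed point equation up to \<open>o(p)\<close>.\<close>

lemma renyi_map_curve_has_vector_derivative:
  assumes A: "\<And>j. j \<in> {1..n} \<Longrightarrow> A j \<in> PD" and w: "w \<in> prob_vectors n" and z: "0 < z"
    and H: "H = (\<Sum>j=1..n. w j *\<^sub>R op_log (A j))"
  shows "((\<lambda>p. renyi_map t z n w (tuple_powr A p) (op_exp (p *\<^sub>R H))) has_vector_derivative H) (at 0)"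
    and "renyi_map t z n w (tuple_powr A 0) (op_exp (0 *\<^sub>R H)) = id_blinfun"
proof -
  let ?c = "(1 - t) / (2 * z)"
  let ?C = "\<lambda>j p. op_powr (op_powr (A j) p) ?c" and ?Y = "\<lambda>p. op_powr (op_exp (p *\<^sub>R H)) (t / z)"
  let ?T = "\<lambda>j p. ?C j p o\<^sub>L ?Y p o\<^sub>L ?C j p"
  have w1: "(\<Sum>j=1..n. w j) = 1" using w by (simp add: prob_vectors_def)
  have sH: "selfadjoint H"
    unfolding H using A
    by (intro selfadjoint_sum selfadjoint_scaleR selfadjoint_log)
  have T: "(?T j has_vector_derivative ((1 - t) / z) *\<^sub>R op_log (A j) + (t / z) *\<^sub>R H) (at 0)"
    and TP: "\<And>p. ?T j p \<in> PD" and T0: "?T j 0 = id_blinfun" if j: "j \<in> {1..n}" for j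
  proof -
    have "((\<lambda>p. op_powr (A j) p) has_vector_derivative op_log (A j)) (at 0)"
      unfolding op_powr_eq_exp_log[OF A[OF j]]
      by (rule exp_curve_has_vector_derivative[OF selfadjoint_log[OF A[OF j]]])
    then have C: "(?C j has_vector_derivative ?c *\<^sub>R op_log (A j)) (at 0)"
      by (rule powr_curve_has_vector_derivative) (use A[OF j] in \<open>auto intro: op_powr_PD op_powr_0\<close>)
    have C0: "?C j 0 = id_blinfun" using A[OF j] by (simp add: op_powr_0 op_powr_id)
    have Y: "(?Y has_vector_derivative (t / z) *\<^sub>R H) (at 0)"
      by (rule powr_curve_has_vector_derivative[OF exp_curve_has_vector_derivative[OF sH]])
         (auto intro: exp_PD selfadjoint_scaleR sH op_exp_0)
    have Y0: "?Y 0 = id_blinfun" by (simp add: op_exp_0 op_powr_id)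
    have "?c *\<^sub>R op_log (A j) + ?c *\<^sub>R op_log (A j) = ((1 - t) / z) *\<^sub>R op_log (A j)"
      by (simp flip: scaleR_add_left)
    then show "(?T j has_vector_derivative ((1 - t) / z) *\<^sub>R op_log (A j) + (t / z) *\<^sub>R H) (at 0)"
      using bounded_bilinear.has_vector_derivative[OF bounded_bilinear_blinfun_compose
          bounded_bilinear.has_vector_derivative[OF bounded_bilinear_blinfun_compose C Y] C]
      unfolding C0 Y0 by (simp add: algebra_simps)
    show "?T j p \<in> PD" for p
      by (intro PD_congruence op_powr_PD op_powr_selfadjoint op_powr_invertible exp_PD selfadjoint_scaleR sH A j)
    show "?T j 0 = id_blinfun" unfolding C0 Y0 by simp
  qed
  have eq: "renyi_map t z n w (tuple_powr A p) (op_exp (p *\<^sub>R H)) = (\<Sum>j=1..n. w j *\<^sub>R op_powr (?T j p) z)" for p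
    by (simp add: renyi_map_def tuple_powr_def)
  have "((\<lambda>p. \<Sum>j=1..n. w j *\<^sub>R op_powr (?T j p) z) has_vector_derivative
      (\<Sum>j=1..n. w j *\<^sub>R (z *\<^sub>R (((1 - t) / z) *\<^sub>R op_log (A j) + (t / z) *\<^sub>R H)))) (at 0)"
    by (intro has_vector_derivative_sum bounded_linear.has_vector_derivative[OF bounded_linear_scaleR_right]
        powr_curve_has_vector_derivative T TP T0)
  also have "(\<Sum>j=1..n. w j *\<^sub>R (z *\<^sub>R (((1 - t) / z) *\<^sub>R op_log (A j) + (t / z) *\<^sub>R H)))
      = (\<Sum>j=1..n. (1 - t) *\<^sub>R (w j *\<^sub>R op_log (A j)) + w j *\<^sub>R (t *\<^sub>R H))"
    using z by (intro sum.cong) (auto simp: scaleR_add_right mult.commute)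
  also have "\<dots> = (1 - t) *\<^sub>R H + (\<Sum>j=1..n. w j) *\<^sub>R (t *\<^sub>R H)"
    unfolding sum.distrib H scaleR_sum_right[symmetric] scaleR_sum_left[symmetric] ..
  also have "\<dots> = H" unfolding w1 by (simp add: algebra_simps)
  finally show "((\<lambda>p. renyi_map t z n w (tuple_powr A p) (op_exp (p *\<^sub>R H))) has_vector_derivative H) (at 0)"
    unfolding eq .
  have "renyi_map t z n w (tuple_powr A 0) (op_exp (0 *\<^sub>R H)) = (\<Sum>j=1..n. w j *\<^sub>R id_blinfun)"
    unfolding eq by (intro sum.cong refl) (simp only: T0 op_powr_id)
  also have "\<dots> = id_blinfun" unfolding scaleR_sum_left[symmetric] w1 by simp
  finally show "renyi_map t z n w (tuple_powr A 0) (op_exp (0 *\<^sub>R H)) = id_blinfun" .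
qed

lemma eventually_near_id_bounds:
  assumes X: "(X has_vector_derivative K) (at (0::real))" and X0: "X 0 = id_blinfun" and s: "\<And>p. selfadjoint (X p)"
  shows "\<forall>\<^sub>F p in nhds 0. loewner_le id_blinfun (2 *\<^sub>R X p) \<and> loewner_le (X p) (2 *\<^sub>R id_blinfun)"
proof -
  have "(X \<longlongrightarrow> X 0) (nhds 0)"
    using has_vector_derivative_continuous[OF X]
    unfolding isCont_def tendsto_at_iff_tendsto_nhds[of X] .
  then have "\<forall>\<^sub>F p in nhds 0. dist (X p) id_blinfun < 1 / 2" unfolding X0 by (rule tendstoD) simp
  then show ?thesis
  proof eventually_elim
    case (elim p)
    have "op_between (1 / 2) 2 (X p)"
      using op_between_mono[OF op_between_near_scalar[OF s, of 1 p]] elim by (simp add: dist_norm)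
    then show ?case
      using loewner_le_scaleR[of 2 "(1 / 2) *\<^sub>R id_blinfun" "X p"] by (simp add: op_between_loewner)
  qed
qed

text \<open>The curve \<open>Y p = exp (p H)\<close> is an approximate fixed point with error \<open>D p - Y p = o(p)\<close>, and comparison of
sub- and supersolutions multiplies the error at most by a constant, so the true fixed point differs
from \<open>Y p\<close> by \<open>o(p)\<close>.\<close>

theorem renyi_mean_curve_has_vector_derivative:
  assumes A: "\<And>j. j \<in> {1..n} \<Longrightarrow> A j \<in> PD" and w: "w \<in> prob_vectors n"
    and t: "0 \<le> t" "t < z" "z \<le> 1"
    and H: "H = (\<Sum>j=1..n. w j *\<^sub>R op_log (A j))"
  shows "((\<lambda>p. renyi_mean t z n w (tuple_powr A p)) has_vector_derivative H) (at 0)"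
    and "renyi_mean t z n w (tuple_powr A 0) = id_blinfun"
proof -
  have sH: "selfadjoint H"
    unfolding H by (intro selfadjoint_sum selfadjoint_scaleR selfadjoint_log A)
  have z: "0 < z" and t1: "t < 1" using t by auto
  have Ap: "tuple_powr A p j \<in> PD" if "j \<in> {1..n}" for p j
    using A[OF that] by (simp add: tuple_powr_def op_powr_PD)
  define F where "F p = renyi_map t z n w (tuple_powr A p)" for p
  define X where "X p = renyi_mean t z n w (tuple_powr A p)" for p
  define Y where "Y p = op_exp (p *\<^sub>R H)" for p
  define D where "D p = F p (Y p)" for p
  have hom: "homogeneous_order_map (F p) t" for p
    unfolding F_def using Ap w t by (rule homogeneous_order_map_renyi_map)
  have XP: "X p \<in> PD" and FX: "F p (X p) = X p" for p
    unfolding X_def F_def using renyi_mean_fixed_point[of n "tuple_powr A p" w t z] Ap w t by blast+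
  have YP: "Y p \<in> PD" for p unfolding Y_def by (intro exp_PD selfadjoint_scaleR sH)
  have DP: "D p \<in> PD" for p unfolding D_def by (rule homogeneous_order_map.PD[OF hom YP])
  have Y: "(Y has_vector_derivative H) (at 0)" "Y 0 = id_blinfun"
    unfolding Y_def using exp_curve_has_vector_derivative[OF sH] by (auto simp: op_exp_0)
  have D: "(D has_vector_derivative H) (at 0)" "D 0 = id_blinfun"
    unfolding D_def F_def Y_def by (rule renyi_map_curve_has_vector_derivative; fact)+
  have DY: "((\<lambda>p. D p - Y p) has_vector_derivative 0) (at 0)" "D 0 - Y 0 = 0"
    using has_vector_derivative_diff[OF D(1) Y(1)] D(2) Y(2) by simp_all
  let ?k = "2 / (1 - t)"
  let ?u = "\<lambda>p. ?k * norm (D p - Y p)"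
  have "((\<lambda>p. D p - Y p) \<longlongrightarrow> D 0 - Y 0) (nhds 0)"
    using has_vector_derivative_continuous[OF DY(1)] unfolding isCont_def tendsto_at_iff_tendsto_nhds[of "\<lambda>p. D p - Y p"] .
  then have "(?u \<longlongrightarrow> ?k * norm (D 0 - Y 0)) (nhds 0)"
    by (intro tendsto_mult_left tendsto_norm)
  then have u_small: "\<forall>\<^sub>F p in nhds 0. ?u p < ln 2"
    by (rule order_tendstoD(2)) (simp add: DY(2))
  have "\<forall>\<^sub>F p in nhds 0. norm (X p - Y p) \<le> (8 * ?k) * norm (D p - Y p)"
    using u_small eventually_near_id_bounds[OF D PD_selfadjoint[OF DP]] eventually_near_id_bounds[OF Y PD_selfadjoint[OF YP]]
  proof eventually_elim
    case (elim p)
    let ?e = "norm (D p - Y p)"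
    have u: "0 \<le> ?u p" using t1 by simp
    have DleY: "loewner_le (D p) (exp (2 * ?e) *\<^sub>R Y p)"
      by (intro loewner_le_exp_of_norm YP PD_selfadjoint[OF DP]) (use elim in auto)
    have YleD: "loewner_le (Y p) (exp (2 * ?e) *\<^sub>R D p)"
      unfolding norm_minus_commute[of "D p"]
      by (intro loewner_le_exp_of_norm DP PD_selfadjoint[OF YP]) (use elim in auto)
    have XY: "loewner_le (X p) (exp (?u p) *\<^sub>R Y p)"
      using homogeneous_order_map.subsolution_le_supersolution[OF hom[of p], where X = "X p" and l = 0 and Y = "Y p" and l' = "2 * ?e"]
        XP YP DleY
      by (simp add: FX D_def)
    have YX: "loewner_le (Y p) (exp (?u p) *\<^sub>R X p)"
      using homogeneous_order_map.subsolution_le_supersolution[OF hom[of p], where X = "Y p" and l = "2 * ?e" and Y = "X p" and l' = 0]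
        XP YP YleD
      by (simp add: FX D_def)
    have e2: "exp (?u p) \<le> 2" using elim by (metis exp_ln exp_le_cancel_iff less_imp_le zero_less_numeral)
    \<comment> \<open>The factor \<open>exp (?u p) \<le> 2\<close> turns the bound \<open>2 I\<close> for \<open>Y p\<close> into \<open>4 I\<close> for \<open>X p\<close>.\<close>
    have Y4: "loewner_le (Y p) (4 *\<^sub>R id_blinfun)"
      by (rule loewner_le_trans[OF _ loewner_le_scaleR_left[of 2]]) (use elim in auto)
    have "loewner_le (X p) (exp (?u p) *\<^sub>R (2 *\<^sub>R id_blinfun))"
      by (rule loewner_le_trans[OF XY loewner_le_scaleR]) (use elim in auto)
    also have "loewner_le (exp (?u p) *\<^sub>R (2 *\<^sub>R id_blinfun)) (4 *\<^sub>R id_blinfun)"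
      using loewner_le_scaleR_left[of "exp (?u p) * 2" 4 id_blinfun] e2 by simp
    finally have X4: "loewner_le (X p) (4 *\<^sub>R id_blinfun)" .
    have "norm (X p - Y p) \<le> (exp (?u p) - 1) * 4"
      by (rule norm_diff_le_of_ratio[OF XY YX u _ XP X4 YP Y4]) simp
    also have "exp (?u p) - 1 \<le> ?u p * exp (?u p)" by (rule exp_minus_one_le)
    also have "\<dots> \<le> ?u p * 2" by (rule mult_left_mono[OF e2 u])
    finally show ?case by simp
  qed
  note bd = this
  have XY': "((\<lambda>p. X p - Y p) has_vector_derivative 0) (at 0)"
    by (rule has_vector_derivative_0_dominated[OF DY bd])
  have "X 0 - Y 0 = 0" using eventually_nhds_x_imp_x[OF bd] DY(2) by simp
  then show "renyi_mean t z n w (tuple_powr A 0) = id_blinfun" using Y(2) by (simp add: X_def)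
  show "((\<lambda>p. renyi_mean t z n w (tuple_powr A p)) has_vector_derivative H) (at 0)"
    using has_vector_derivative_add[OF XY' Y(1)] by (simp add: X_def)
qed

text \<open>Since \<open>X\<^bsup>1/p\<^esup> = exp (log X / p)\<close>, the limit is the exponential of the derivative of \<open>log X\<close> at \<open>p = 0\<close>.\<close>

theorem renyi_mean_powr_tendsto_exp:
  assumes A: "\<And>j. j \<in> {1..n} \<Longrightarrow> A j \<in> PD" and w: "w \<in> prob_vectors n"
    and t: "0 \<le> t" "t < z" "z \<le> 1"
    and H: "H = (\<Sum>j=1..n. w j *\<^sub>R op_log (A j))"
  shows "((\<lambda>p. op_powr (renyi_mean t z n w (tuple_powr A p)) (1 / p)) \<longlongrightarrow> op_exp H) (at 0)"
proof -
  let ?X = "\<lambda>p. renyi_mean t z n w (tuple_powr A p)"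
  have XP: "?X p \<in> PD" for p
    using A by (intro renyi_mean_fixed_point w t) (simp add: tuple_powr_def op_powr_PD)
  have sH: "selfadjoint H"
    unfolding H by (intro selfadjoint_sum selfadjoint_scaleR selfadjoint_log A)
  have X: "(?X has_vector_derivative H) (at 0)" "?X 0 = id_blinfun"
    by (rule renyi_mean_curve_has_vector_derivative; fact)+
  have "((\<lambda>p. op_log (?X p)) has_vector_derivative H) (at 0)"
    by (rule log_curve_has_vector_derivative[OF X XP])
  then have "((\<lambda>p. (1 / p) *\<^sub>R op_log (?X p)) \<longlongrightarrow> H) (at 0)"
    unfolding has_vector_derivative_at_0_iff X(2) op_log_id by simp
  then have "((\<lambda>p. op_exp ((1 / p) *\<^sub>R op_log (?X p))) \<longlongrightarrow> op_exp H) (at 0)"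
    by (rule tendsto_op_exp) (auto intro!: always_eventually selfadjoint_scaleR selfadjoint_log XP sH)
  then show ?thesis by (simp add: op_powr_eq_exp_log[OF XP])
qed

section \<open>Thompson limits and the near-order\<close>

lemma norm_powr_half_sandwich_le:
  assumes X: "X \<in> PD"
  shows "norm (op_powr X (1/2) o\<^sub>L Z o\<^sub>L op_powr X (1/2)) \<le> norm X * norm Z"
proof -
  let ?S = "op_powr X (1/2)"
  have "norm ?S \<le> sqrt (norm X)"
  proof (rule norm_blinfun_bound)
    fix x
    have "(norm (blinfun_apply ?S x))\<^sup>2 = inner x (blinfun_apply (?S o\<^sub>L ?S) x)"
      by (simp add: power2_norm_eq_inner selfadjoint_inner[OF op_powr_selfadjoint[OF X]])
    also have "?S o\<^sub>L ?S = X" by (simp add: op_powr_add[OF X] op_powr_1[OF X])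
    also have "inner x (blinfun_apply X x) \<le> norm X * inner x x"
      using abs_inner_blinfun_le[of x X] by linarith
    also have "\<dots> = (sqrt (norm X) * norm x)\<^sup>2" by (simp add: power_mult_distrib power2_norm_eq_inner)
    finally show "norm (blinfun_apply ?S x) \<le> sqrt (norm X) * norm x" by (rule power2_le_imp_le) simp
  qed simp
  then have "norm ?S * norm ?S \<le> sqrt (norm X) * sqrt (norm X)" by (intro mult_mono) auto
  then have S: "norm ?S * norm ?S \<le> norm X" by simp
  have "norm (?S o\<^sub>L Z o\<^sub>L ?S) \<le> norm (?S o\<^sub>L Z) * norm ?S" by (rule norm_blinfun_compose)
  also have "\<dots> \<le> (norm ?S * norm Z) * norm ?S" by (intro mult_right_mono norm_blinfun_compose) simp
  also have "\<dots> = (norm ?S * norm ?S) * norm Z" by simp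
  also have "\<dots> \<le> norm X * norm Z" by (intro mult_right_mono S) simp
  finally show ?thesis .
qed

text \<open>Thompson convergence says that \<open>C = X\<^bsup>-1/2\<^esup> L X\<^bsup>-1/2\<^esup>\<close> has logarithm tending to \<open>0\<close>, so \<open>C\<close> tends to \<open>I\<close>, and
\<open>L - X = X\<^bsup>1/2\<^esup> (C - I) X\<^bsup>1/2\<^esup>\<close> tends to \<open>0\<close> in norm.\<close>

lemma thompson_lim_unique:
  assumes lim: "thompson_lim X L F" and X: "(X \<longlongrightarrow> E) F" and XP: "\<And>p. X p \<in> PD" and F: "F \<noteq> bot"
  shows "L = E"
proof -
  have LP: "L \<in> PD" and th: "((\<lambda>p. thompson (X p) L) \<longlongrightarrow> 0) F"
    using lim by (auto simp: thompson_lim_def)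
  define C where "C p = op_powr (X p) (-1/2) o\<^sub>L L o\<^sub>L op_powr (X p) (-1/2)" for p
  have CP: "C p \<in> PD" for p
    unfolding C_def by (intro PD_congruence LP op_powr_selfadjoint op_powr_invertible XP)
  have "((\<lambda>p. op_log (C p)) \<longlongrightarrow> 0) F"
    using th unfolding thompson_def C_def by (rule tendsto_norm_zero_cancel)
  then have "((\<lambda>p. op_exp (op_log (C p))) \<longlongrightarrow> op_exp 0) F"
    by (rule tendsto_op_exp) (auto intro!: always_eventually selfadjoint_log CP)
  then have "((\<lambda>p. C p) \<longlongrightarrow> id_blinfun) F" by (simp add: op_exp_log[OF CP] op_exp_0)
  then have C0: "((\<lambda>p. C p - id_blinfun) \<longlongrightarrow> 0) F" by (simp add: LIM_zero)
  have "L - X p = op_powr (X p) (1/2) o\<^sub>L (C p - id_blinfun) o\<^sub>L op_powr (X p) (1/2)" for p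
  proof -
    let ?S = "op_powr (X p) (1/2)" and ?S' = "op_powr (X p) (-1/2)"
    have S: "?S o\<^sub>L ?S' = id_blinfun" "?S' o\<^sub>L ?S = id_blinfun" "?S o\<^sub>L ?S = X p"
      by (simp_all add: op_powr_add[OF XP] op_powr_0[OF XP] op_powr_1[OF XP])
    have "?S o\<^sub>L C p o\<^sub>L ?S = (?S o\<^sub>L ?S') o\<^sub>L L o\<^sub>L (?S' o\<^sub>L ?S)"
      unfolding C_def blinfun_compose_assoc ..
    also have "\<dots> = L" unfolding S(1,2) by simp
    finally have e: "?S o\<^sub>L C p o\<^sub>L ?S = L" .
    show ?thesis by (simp only: blinfun_compose_simps e blinfun_compose_id_right S(3))
  qed
  then have bound: "norm (L - X p) \<le> norm (X p) * norm (C p - id_blinfun)" for p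
    using norm_powr_half_sandwich_le[OF XP, of p "C p - id_blinfun"] by (simp only:)
  have "((\<lambda>p. norm (X p) * norm (C p - id_blinfun)) \<longlongrightarrow> 0) F"
    using tendsto_mult[OF tendsto_norm[OF X] tendsto_norm[OF C0]] by simp
  then have "((\<lambda>p. L - X p) \<longlongrightarrow> 0) F"
    by (rule Lim_null_comparison[OF always_eventually[OF allI[OF bound]]])
  moreover have "((\<lambda>p. L - X p) \<longlongrightarrow> L - E) F" by (intro tendsto_intros X)
  ultimately have "L - E = 0" using tendsto_unique[OF F] by blast
  then show ?thesis by simp
qed

text \<open>Functions of one operator commute, and for commuting operators the geometric mean of \<open>f(H)\<^bsup>-1\<^esup>\<close> and \<open>g(H)\<close> is
\<open>(g / f)\<^bsup>1/2\<^esup>(H)\<close>.\<close>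

lemma near_le_cfc:
  assumes H: "op_between a b H" and f: "continuous_on {a..b} f" and g: "continuous_on {a..b} g"
    and pos: "\<And>x. x \<in> {a..b} \<Longrightarrow> 0 < f x" and le: "\<And>x. x \<in> {a..b} \<Longrightarrow> f x \<le> g x"
  shows "near_le (cfc f H) (cfc g H)"
proof -
  have gpos: "0 < g x" if "x \<in> {a..b}" for x using pos[OF that] le[OF that] by linarith
  let ?i = "\<lambda>x. 1 / f x"
  have i: "continuous_on {a..b} ?i" and ipos: "\<And>x. x \<in> {a..b} \<Longrightarrow> 0 < ?i x"
    using pos by (auto intro!: continuous_on_divide f simp: less_imp_neq[symmetric])
  have cp: "continuous_on {a..b} (\<lambda>x. ?i x powr r)" for r
    by (rule continuous_on_compose2[OF continuous_on_powr_pos i]) (use ipos in blast)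
  have inv: "op_inverse (cfc f H) = cfc ?i H"
  proof (rule op_inverse_eqI)
    have "cfc (\<lambda>x. f x * ?i x) H = cfc (\<lambda>x. 1) H"
      by (rule cfc_cong[OF H continuous_on_mult[OF f i]]) (use pos in force)
    then show 1: "cfc f H o\<^sub>L cfc ?i H = id_blinfun"
      using cfc_mult[OF H f i] cfc_const[OF H, of 1] by simp
    show "cfc ?i H o\<^sub>L cfc f H = id_blinfun"
      using cfc_mult[OF H f i] cfc_mult[OF H i f] 1 by (simp add: mult.commute)
  qed
  let ?m = "\<lambda>x. ?i x powr (-1/2) * g x * ?i x powr (-1/2)"
  have m: "continuous_on {a..b} ?m" and mpos: "\<And>x. x \<in> {a..b} \<Longrightarrow> 0 < ?m x"
    using cp[of "-1/2"] g ipos gpos by (auto intro!: continuous_on_mult) (use pos in force)+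
  have cm: "continuous_on {a..b} (\<lambda>x. ?m x powr (1/2))"
    by (rule continuous_on_compose2[OF continuous_on_powr_pos m]) (use mpos in blast)
  let ?G = "\<lambda>x. ?i x powr (1/2) * ?m x powr (1/2) * ?i x powr (1/2)"
  have "geom_mean (op_inverse (cfc f H)) (cfc g H) = cfc ?G H"
    unfolding inv geom_mean_def
    by (simp only: op_powr_cfc[OF H i ipos] op_powr_cfc[OF H m mpos] cfc_mult[OF H, symmetric]
        cp cm g m continuous_on_mult)
  moreover have "1 \<le> ?G x" if x: "x \<in> {a..b}" for x
  proof -
    have "?m x = g x * (?i x powr (-1/2) * ?i x powr (-1/2))" by (simp only: mult_ac)
    also have "?i x powr (-1/2) * ?i x powr (-1/2) = ?i x powr (-1/2 + -1/2)"
      by (simp only: powr_add)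
    also have "\<dots> = f x" using pos[OF x] by (simp add: powr_minus)
    finally have "?G x = (?i x powr (1/2) * ?i x powr (1/2)) * (g x * f x) powr (1/2)" by (simp only: mult_ac)
    also have "\<dots> = ?i x * sqrt (g x * f x)"
      using pos[OF x] gpos[OF x] by (simp flip: powr_add add: powr_half_sqrt)
    also have "\<dots> \<ge> ?i x * sqrt (f x * f x)"
      using pos[OF x] le[OF x] by (intro mult_left_mono real_sqrt_le_mono mult_right_mono) auto
    also have "?i x * sqrt (f x * f x) = 1" using pos[OF x] by simp
    finally show ?thesis .
  qed
  moreover have "continuous_on {a..b} ?G" by (intro continuous_on_mult cp cm)
  ultimately show ?thesis
    unfolding near_le_def
    using cfc_mono[OF H continuous_on_const, of ?G 1] selfadjoint_cfc[OF H, of ?G]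
    by (simp add: cfc_const[OF H] loewner_le_iff)
qed

theorem theorem5p6:
  fixes n :: nat and t z :: real and w :: "nat \<Rightarrow> real"
    and A :: "nat \<Rightarrow> ('a::chilbert_space \<Rightarrow>\<^sub>L 'a)"
  assumes "\<And>j. j \<in> {1..n} \<Longrightarrow> A j \<in> PD"
    and "w \<in> prob_vectors n"
    and "0 \<le> t" and "t < z" and "z \<le> 1"
  shows "(\<forall>Lminus Lplus.
            thompson_lim (\<lambda>p. op_powr (renyi_mean t z n w (tuple_powr A p)) (1 / p)) Lminus (at_left 0) \<longrightarrow>
            thompson_lim (\<lambda>p. op_powr (renyi_mean t z n w (tuple_powr A p)) (1 / p)) Lplus (at_right 0) \<longrightarrow>
            near_le Lminus Lplus)
      \<and> (\<forall>Lplus.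
            thompson_lim (\<lambda>p. op_powr (renyi_mean t z n w (tuple_powr A p)) (1 / p)) Lplus (at_right 0) \<longrightarrow>
            (\<forall>j\<in>{1..n}. loewner_le (A j) id_blinfun) \<longrightarrow>
            near_le Lplus (log_euclidean n w (tuple_powr A (1 - t))))
      \<and> (\<forall>Lminus.
            thompson_lim (\<lambda>p. op_powr (renyi_mean t z n w (tuple_powr A p)) (1 / p)) Lminus (at_left 0) \<longrightarrow>
            (\<forall>j\<in>{1..n}. loewner_le id_blinfun (A j)) \<longrightarrow>
            near_le (log_euclidean n w (tuple_powr A (1 - t))) Lminus)"
proof -
  let ?R = "\<lambda>p. op_powr (renyi_mean t z n w (tuple_powr A p)) (1 / p)"
  define H where "H = (\<Sum>j=1..n. w j *\<^sub>R op_log (A j))"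
  have wpos: "0 \<le> w j" if "j \<in> {1..n}" for j using assms(2) that by (auto simp: prob_vectors_def intro: less_imp_le)
  have sH: "selfadjoint H"
    unfolding H_def by (intro selfadjoint_sum selfadjoint_scaleR selfadjoint_log assms(1))
  have bH: "op_between (- norm H) (norm H) H" by (rule op_between_norm[OF sH])
  have RP: "?R p \<in> PD" for p
    by (intro op_powr_PD renyi_mean_fixed_point assms(2-)) (simp add: tuple_powr_def op_powr_PD assms(1))
  have lim: "(?R \<longlongrightarrow> op_exp H) (at 0)"
    by (rule renyi_mean_powr_tendsto_exp; fact assms H_def)
  have limit_eq: "L = op_exp H" if "thompson_lim ?R L (at 0 within S)" "at 0 within S \<noteq> bot" for L S
    by (rule thompson_lim_unique[OF that(1) tendsto_within_subset[OF lim subset_UNIV] RP that(2)])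
  have left: "L = op_exp H" if "thompson_lim ?R L (at_left 0)" for L
    by (rule limit_eq[OF that]) simp
  have right: "L = op_exp H" if "thompson_lim ?R L (at_right 0)" for L
    by (rule limit_eq[OF that]) simp
  have LE: "log_euclidean n w (tuple_powr A (1 - t)) = cfc (\<lambda>x. exp ((1 - t) * x)) H"
  proof -
    have "log_euclidean n w (tuple_powr A (1 - t)) = op_exp (\<Sum>j=1..n. w j *\<^sub>R ((1 - t) *\<^sub>R op_log (A j)))"
      unfolding log_euclidean_def tuple_powr_def
      by (intro arg_cong[of _ _ op_exp] sum.cong refl) (simp add: op_log_powr assms(1))
    also have "(\<Sum>j=1..n. w j *\<^sub>R ((1 - t) *\<^sub>R op_log (A j))) = (1 - t) *\<^sub>R H"
      unfolding H_def scaleR_sum_right by (intro sum.cong refl) (simp add: mult.commute)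
    also have "op_exp ((1 - t) *\<^sub>R H) = cfc exp (cfc (\<lambda>x. (1 - t) * x) H)"
      unfolding op_exp_def using cfc_scale[OF bH, of "\<lambda>x. x" "1 - t"] cfc_id[OF bH] by simp
    also have "\<dots> = cfc (\<lambda>x. exp ((1 - t) * x)) H"
    proof (rule cfc_compose[OF bH])
      fix x assume "x \<in> {- norm H..norm H}"
      then have "\<bar>(1 - t) * x\<bar> \<le> \<bar>1 - t\<bar> * norm H"
        unfolding abs_mult by (intro mult_left_mono) auto
      then show "(1 - t) * x \<in> {- (\<bar>1 - t\<bar> * norm H)..\<bar>1 - t\<bar> * norm H}" by (auto simp: abs_le_iff)
    qed (auto intro!: continuous_intros)
    finally show ?thesis .
  qed
  have part0: "near_le (op_exp H) (op_exp H)"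
    unfolding op_exp_def by (rule near_le_cfc[OF bH]) (auto intro!: continuous_intros)
  have partI: "near_le (op_exp H) (log_euclidean n w (tuple_powr A (1 - t)))"
    if le: "\<forall>j\<in>{1..n}. loewner_le (A j) id_blinfun"
  proof -
    have "loewner_le H (\<Sum>j=1..n. w j *\<^sub>R 0)"
      unfolding H_def
    proof (intro loewner_le_sum loewner_le_scaleR wpos)
      fix j assume j: "j \<in> {1..n}"
      obtain a b where a: "0 < a" "op_between a b (A j)" using assms(1)[OF j] by (rule PD_obtain_bounds)
      then have B: "op_between a 1 (A j)" using le j by (simp add: op_between_loewner)
      then have "op_between (ln a) 0 (op_log (A j))"
        unfolding op_log_def by (rule cfc_between) (use a(1) in \<open>auto intro!: continuous_intros\<close>)
      then show "loewner_le (op_log (A j)) 0" by (simp add: op_between_loewner)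
    qed
    then have B: "op_between (- norm H) 0 H" using bH by (simp add: op_between_loewner)
    \<comment> \<open>On the nonpositive axis, where the spectrum of \<open>H\<close> lies, \<open>exp x \<le> exp ((1 - t) x)\<close>.\<close>
    have "x \<le> (1 - t) * x" if "x \<le> 0" for x
      using mult_nonneg_nonpos[OF assms(3) that] by (simp add: algebra_simps)
    then show ?thesis
      unfolding LE op_exp_def by (intro near_le_cfc[OF B]) (auto intro!: continuous_intros)
  qed
  have partII: "near_le (log_euclidean n w (tuple_powr A (1 - t))) (op_exp H)"
    if le: "\<forall>j\<in>{1..n}. loewner_le id_blinfun (A j)"
  proof -
    have "loewner_le (\<Sum>j=1..n. w j *\<^sub>R 0) H"
      unfolding H_def
    proof (intro loewner_le_sum loewner_le_scaleR wpos)
      fix j assume j: "j \<in> {1..n}"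
      obtain a b where "op_between a b (A j)" using assms(1)[OF j] by (rule PD_obtain_bounds)
      then have B: "op_between 1 b (A j)" using le j by (simp add: op_between_loewner)
      then have "op_between 0 (ln b) (op_log (A j))"
        unfolding op_log_def by (rule cfc_between) (auto intro!: continuous_intros)
      then show "loewner_le 0 (op_log (A j))" by (simp add: op_between_loewner)
    qed
    then have B: "op_between 0 (norm H) H" using bH by (simp add: op_between_loewner)
    have "(1 - t) * x \<le> x" if "0 \<le> x" for x
      using mult_nonneg_nonneg[OF assms(3) that] by (simp add: algebra_simps)
    then show ?thesis
      unfolding LE op_exp_def by (intro near_le_cfc[OF B]) (auto intro!: continuous_intros)
  qed
  show ?thesis
  proof (intro conjI allI impI)
    fix Lminus Lplus
    assume "thompson_lim ?R Lminus (at_left 0)" "thompson_lim ?R Lplus (at_right 0)"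
    from left[OF this(1)] right[OF this(2)] part0 show "near_le Lminus Lplus" by simp
  next
    fix Lplus
    assume "thompson_lim ?R Lplus (at_right 0)" and le: "\<forall>j\<in>{1..n}. loewner_le (A j) id_blinfun"
    from right[OF this(1)] partI[OF le] show "near_le Lplus (log_euclidean n w (tuple_powr A (1 - t)))" by simp
  next
    fix Lminus
    assume "thompson_lim ?R Lminus (at_left 0)" and le: "\<forall>j\<in>{1..n}. loewner_le id_blinfun (A j)"
    from left[OF this(1)] partII[OF le] show "near_le (log_euclidean n w (tuple_powr A (1 - t))) Lminus" by simp
  qed
qed

end
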